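(* The set of positive integers that are not numerators of the orbit $\Psi\begin{pmatrix}2\\3\end{pmatrix}$ is equal to \[\{n^2:n\in\mathbb{Z}^+\}\cup\{3,6,7,10,12,15,18,19,27,31,34,55,63,99,115\}.\]
   Context: $\left(\frac{x}{y}\right)$ denotes the Kronecker symbol. $\Gamma_1(4)^{\geq 0}$ is the set of matrices $\begin{pmatrix} a & b\\ c & d\end{pmatrix}\in\mathrm{SL}(2,\mathbb{Z})$ with all entries nonnegative, $a\equiv d\equiv 1\pmod 4$, $c\equiv 0\pmod 4$. $\Psi$ is the semigroup of those $\begin{pmatrix} a & b\\ c & d\end{pmatrix}\in\Gamma_1(4)^{\geq 0}$ such that $\left(\frac{x}{y}\right)=\left(\frac{ax+by}{cx+dy}\right)$ for all nonnegative integers $x,y$ with $y$ odd. A numerator of $\Psi\begin{pmatrix}2\\3\end{pmatrix}$ is the first coordinate of some vector $\gamma\begin{pmatrix}2\\3\end{pmatrix}$ with $\gamma\in\Psi$. *)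

theory Defs
  imports "HOL-Analysis.Analysis" "HOL-Number_Theory.Number_Theory"
begin

definition kronecker_prime :: "int \<Rightarrow> int \<Rightarrow> int" where
  "kronecker_prime a p =
     (if p = 2 then (if even a then 0 else if a mod 8 = 1 \<or> a mod 8 = 7 then 1 else -1)
      else Legendre a p)"

text \<open>
  The Kronecker symbol on all pairs of integers: multiplicative in the lower argument over the
  factorisation into a unit and positive primes, with the usual conventions for the lower
  arguments \<open>-1\<close> (the sign of \<open>a\<close>, with \<open>0\<close> counted as positive) and \<open>0\<close>.
\<close>
definition kronecker :: "int \<Rightarrow> int \<Rightarrow> int" where
  "kronecker a n =
     (if n = 0 then (if \<bar>a\<bar> = 1 then 1 else 0)
      else (if n < 0 \<and> a < 0 then -1 else 1) *
           (\<Prod>p\<in>prime_factors n. kronecker_prime a p ^ multiplicity p n))"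

definition Gamma1_4_nonneg :: "(int ^ 2 ^ 2) set" where
  "Gamma1_4_nonneg =
     {\<gamma>. det \<gamma> = 1 \<and> (\<forall>i j. 0 \<le> \<gamma> $ i $ j) \<and>
         [\<gamma> $ 1 $ 1 = 1] (mod 4) \<and> [\<gamma> $ 2 $ 2 = 1] (mod 4) \<and> [\<gamma> $ 2 $ 1 = 0] (mod 4)}"

definition Psi :: "(int ^ 2 ^ 2) set" where
  "Psi =
     {\<gamma> \<in> Gamma1_4_nonneg. \<forall>x y. 0 \<le> x \<longrightarrow> 0 \<le> y \<longrightarrow> odd y \<longrightarrow>
        kronecker x y =
        kronecker (\<gamma> $ 1 $ 1 * x + \<gamma> $ 1 $ 2 * y) (\<gamma> $ 2 $ 1 * x + \<gamma> $ 2 $ 2 * y)}"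

definition Psi_orbit :: "int ^ 2 \<Rightarrow> (int ^ 2) set" where
  "Psi_orbit v = {\<gamma> *v v | \<gamma>. \<gamma> \<in> Psi}"

definition numerators :: "(int ^ 2) set \<Rightarrow> int set" where
  "numerators V = {v $ 1 | v. v \<in> V}"

end

theory Submission
  imports Defs "HOL-Computational_Algebra.Nth_Powers"
begin

text \<open>
  Since \<open>(ax + by / cx + dy) = (x/y)\<close> for all \<open>x\<close>, \<open>y\<close> as soon as \<open>(b/a) = 1\<close>, the numerators are
  the numbers \<open>n = 2 a + 3 b\<close> with \<open>a = 1\<close> modulo \<open>4\<close> and \<open>(b/a) = 1\<close>. Squares are excluded because
  \<open>(2/3) = -1\<close>. For even \<open>n\<close> there are explicit solutions, and \<open>n\<close> can be multiplied by \<open>4\<close>. For odd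
  \<open>n\<close>, reciprocity turns \<open>(b/a)\<close> into \<open>(b/n)\<close> up to a fixed sign if \<open>b\<close> runs through one residue
  class modulo \<open>8\<close>, so that two such \<open>b < n / 3\<close> with opposite values of \<open>(b/n)\<close> suffice.

  If \<open>n = f s\<^sup>2\<close> with \<open>s \<ge> 7\<close>, both signs occur for \<open>b < 8 f\<close>, and \<open>b\<close> only has to be moved by a
  few multiples of \<open>8 f\<close> to become coprime to \<open>s\<close>. If \<open>n = h G\<close> with coprime factors and \<open>h\<close> not a
  square, some \<open>b < 24 h\<close> can be chosen so that \<open>b\<close> and \<open>b + 8 G\<close> have opposite signs modulo \<open>h\<close>,
  while both are the same modulo \<open>G\<close>; one takes for \<open>G\<close> a prime or a product of two primes. A large
  prime factor with a small cofactor is handled by a bound on runs of residues. What remains are the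
  numbers below \<open>65000\<close>, which are sieved by small primes \<open>a\<close>.
\<close>

subsection \<open>Reciprocity for the Kronecker symbol\<close>

lemma kronecker_eq_prod_mset:
  assumes "n > 0"
  shows "kronecker a n = (\<Prod>p\<in>#prime_factorization n. kronecker_prime a p)"
proof -
  have "(\<Prod>p\<in>#prime_factorization n. kronecker_prime a p) =
        (\<Prod>p\<in>prime_factors n. kronecker_prime a p ^ count (prime_factorization n) p)"
    by (simp add: image_prod_mset_multiplicity)
  also have "\<dots> = (\<Prod>p\<in>prime_factors n. kronecker_prime a p ^ multiplicity p n)"
    by (intro prod.cong refl) (simp add: count_prime_factorization_prime in_prime_factors_iff)
  finally show ?thesis
    using assms by (simp add: kronecker_def)
qed

lemma kronecker_1_right [simp]: "kronecker a 1 = 1"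
  by (simp add: kronecker_eq_prod_mset)

lemma kronecker_mult_right:
  assumes "m > 0" "n > 0"
  shows "kronecker a (m * n) = kronecker a m * kronecker a n"
  using assms by (simp add: kronecker_eq_prod_mset prime_factorization_mult)

lemma kronecker_prime_right:
  assumes "prime p" "p \<noteq> 2"
  shows "kronecker a p = Legendre a p"
  using assms by (simp add: kronecker_eq_prod_mset prime_gt_0_int prime_factorization_prime kronecker_prime_def)

text \<open>Identities for odd lower arguments reduce to Legendre symbols by splitting off one odd
  prime at a time.\<close>

lemma odd_pos_induct [consumes 2, case_names one prime_mult]:
  fixes n :: int
  assumes "odd n" "n > 0"
  assumes one: "P 1"
  assumes step: "\<And>p n. prime p \<Longrightarrow> p > 2 \<Longrightarrow> odd n \<Longrightarrow> n > 0 \<Longrightarrow> P n \<Longrightarrow> P (p * n)"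
  shows "P n"
  using assms(1,2)
proof (induction "nat n" arbitrary: n rule: less_induct)
  case less
  show ?case
  proof (cases "n = 1")
    case False
    then have "\<not> is_unit n"
      using less.prems by auto
    then obtain p where p: "prime p" "p dvd n"
      using less.prems prime_divisor_exists[of n] by auto
    then obtain m where m: "n = p * m"
      by (auto elim: dvdE)
    have "odd p" "odd m"
      using less.prems m by auto
    moreover have "p > 1"
      using p prime_gt_1_int by blast
    ultimately have "p > 2"
      by (cases "p = 2") auto
    have "m > 0"
      using less.prems m \<open>p > 2\<close> by (simp add: zero_less_mult_iff)
    moreover have "m < n"
      using m \<open>p > 2\<close> \<open>m > 0\<close> by simp
    ultimately have "P m"
      using less.hyps[of m] \<open>odd m\<close> by simp
    then show ?thesis
      using step p \<open>p > 2\<close> \<open>odd m\<close> \<open>m > 0\<close> m by blast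
  qed (use one in simp)
qed

section \<open>Legendre symbols via Euler's criterion\<close>

lemma Legendre_cong:
  assumes "[a = b] (mod p)"
  shows "Legendre a p = Legendre b p"
  using assms by (auto simp: Legendre_def QuadRes_def cong_def)

lemma Legendre_values: "Legendre a p \<in> {-1, 0, 1}"
  by (auto simp: Legendre_def)

text \<open>Euler's criterion gives the identity modulo \<open>p\<close>. Both sides lie in {-1, 0,
  1}, and a multiple of \<open>p > 2\<close> of size at most 2 is zero.\<close>

lemma Legendre_mult:
  assumes "prime p" "p > 2"
  shows "Legendre (a * b) p = Legendre a p * Legendre b p"
proof -
  obtain q :: nat where q: "p = int q"
    using assms by (metis zero_le_imp_eq_int prime_ge_0_int)
  have pq: "prime q" "2 < q"
    using assms q by auto
  have "[Legendre (a * b) p = (a * b) ^ ((q - 1) div 2)] (mod p)"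
    using euler_criterion[OF pq] q by simp
  also have "(a * b) ^ ((q - 1) div 2) = a ^ ((q - 1) div 2) * b ^ ((q - 1) div 2)"
    by (simp add: power_mult_distrib)
  also have "[\<dots> = Legendre a p * Legendre b p] (mod p)"
    using cong_mult euler_criterion[OF pq] q cong_sym by blast
  finally have *: "p dvd Legendre (a * b) p - Legendre a p * Legendre b p"
    by (simp add: cong_iff_dvd_diff)
  have "\<bar>Legendre (a * b) p - Legendre a p * Legendre b p\<bar> \<le> 2"
    using Legendre_values[of "a * b" p] Legendre_values[of a p] Legendre_values[of b p] by auto
  then show ?thesis
    using * assms(2) by (smt (verit) dvd_imp_le_int)
qed

lemma Legendre_minus_one:
  assumes "prime p" "p > 2"
  shows "Legendre (-1) p = (if p mod 4 = 3 then -1 else 1)"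
proof -
  obtain q :: nat where q: "p = int q"
    using assms by (metis zero_le_imp_eq_int prime_ge_0_int)
  have pq: "prime q" "2 < q"
    using assms q by auto
  have odd: "odd q"
    using pq prime_odd_nat by blast
  have "[Legendre (-1) p = (-1) ^ ((q - 1) div 2)] (mod p)"
    using euler_criterion[OF pq] q by simp
  moreover have "(-1::int) ^ ((q - 1) div 2) = (if p mod 4 = 3 then -1 else 1)"
  proof (cases "q mod 4 = 1")
    case True
    then obtain k where "q = 4 * k + 1"
      by (metis mult_div_mod_eq)
    then show ?thesis using q by simp
  next
    case False
    then have "q mod 4 = 3" using odd by presburger
    then obtain k where "q = 4 * k + 3"
      by (metis mult_div_mod_eq)
    moreover have "(q - 1) div 2 = 2 * k + 1" using calculation by simp
    ultimately show ?thesis using q by simp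
  qed
  ultimately have *: "p dvd Legendre (-1) p - (if p mod 4 = 3 then -1 else 1)"
    by (simp add: cong_iff_dvd_diff)
  have "\<bar>Legendre (-1) p - (if p mod 4 = 3 then -1 else 1)\<bar> \<le> 2"
    using Legendre_values[of "-1" p] by auto
  then show ?thesis
    using * assms(2) by (smt (verit) dvd_imp_le_int)
qed

section \<open>Basic rules for odd lower arguments\<close>

lemma kronecker_cong:
  assumes "odd n" "n > 0" "[a = b] (mod n)"
  shows "kronecker a n = kronecker b n"
  using assms
proof (induction rule: odd_pos_induct)
  case (prime_mult p n)
  have "[a = b] (mod p)" "[a = b] (mod n)"
    using prime_mult.prems cong_modulus_mult by (blast, metis cong_modulus_mult mult.commute)
  then show ?case
    using prime_mult by (simp add: kronecker_mult_right kronecker_prime_right Legendre_cong[of a b])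
qed simp

lemma kronecker_mult_left:
  assumes "odd n" "n > 0"
  shows "kronecker (a * b) n = kronecker a n * kronecker b n"
  using assms
  by (induction rule: odd_pos_induct)
     (simp_all add: kronecker_mult_right kronecker_prime_right Legendre_mult)

lemma kronecker_values:
  assumes "odd n" "n > 0"
  shows "kronecker a n \<in> {-1, 0, 1}"
  using assms
proof (induction rule: odd_pos_induct)
  case (prime_mult p n)
  then show ?case
    using Legendre_values[of a p] by (auto simp: kronecker_mult_right kronecker_prime_right)
qed simp

lemma kronecker_eq_0_iff:
  assumes "odd n" "n > 0"
  shows "kronecker a n = 0 \<longleftrightarrow> \<not> coprime a n"
  using assms
proof (induction rule: odd_pos_induct)
  case (prime_mult p n)
  have "Legendre a p = 0 \<longleftrightarrow> p dvd a"
    by (auto simp: Legendre_def cong_0_iff)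
  moreover have "coprime a p \<longleftrightarrow> \<not> p dvd a"
    using prime_mult.hyps(1) by (metis coprime_commute prime_imp_coprime prime_def
        coprime_absorb_left prime_elem_def)
  ultimately show ?case
    using prime_mult by (auto simp: kronecker_mult_right kronecker_prime_right)
qed simp

lemma kronecker_one_left [simp]:
  assumes "odd n" "n > 0"
  shows "kronecker 1 n = 1"
proof -
  have "kronecker 1 n \<noteq> 0"
    using kronecker_eq_0_iff[OF assms] by simp
  then show ?thesis
    using kronecker_mult_left[OF assms, of 1 1] by simp
qed

lemma kronecker_square_left:
  assumes "odd n" "n > 0"
  shows "kronecker (a\<^sup>2) n = (if coprime a n then 1 else 0)"
  using assms kronecker_values[OF assms, of a] kronecker_eq_0_iff[OF assms, of a]
  by (auto simp: power2_eq_square kronecker_mult_left)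

text \<open>Being 3 modulo 4 behaves like a sign under multiplication of odd numbers, so the sign in
  the reciprocity law is multiplicative in each argument.\<close>

lemma mod_4_mult_cases:
  fixes m n :: int
  assumes "odd m" "odd n"
  shows "(m * n) mod 4 = 3 \<longleftrightarrow> (m mod 4 = 3) \<noteq> (n mod 4 = 3)"
proof -
  have "m mod 4 = 1 \<or> m mod 4 = 3" "n mod 4 = 1 \<or> n mod 4 = 3"
    using assms by presburger+
  moreover have "(m * n) mod 4 = ((m mod 4) * (n mod 4)) mod 4"
    by (simp add: mod_mult_eq)
  ultimately show ?thesis by auto
qed

lemma kronecker_minus_one:
  assumes "odd n" "n > 0"
  shows "kronecker (-1) n = (if n mod 4 = 3 then -1 else 1)"
  using assms
proof (induction rule: odd_pos_induct)
  case (prime_mult p n)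
  have "odd p" using prime_mult prime_odd_int by blast
  then show ?case
    using prime_mult mod_4_mult_cases[of p n]
    by (simp add: kronecker_mult_right kronecker_prime_right Legendre_minus_one)
qed simp

lemma Legendre_reciprocity:
  assumes "prime p" "p > 2" "prime q" "q > 2"
  shows "Legendre p q = (if p mod 4 = 3 \<and> q mod 4 = 3 then -1 else 1) * Legendre q p"
proof (cases "p = q")
  case True
  then show ?thesis by (simp add: Legendre_def cong_0_iff)
next
  case False
  have nz: "Legendre p q \<noteq> 0" "Legendre q p \<noteq> 0"
    using False assms by (auto simp: Legendre_def cong_0_iff dest: primes_dvd_imp_eq)
  have odd: "odd p" "odd q"
    using assms prime_odd_int by blast+
  define s where "s = (-1::int) ^ (nat ((p - 1) div 2 * ((q - 1) div 2)))"
  have "Legendre p q * Legendre q p = s"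
    unfolding s_def using assms False
    by (intro Quadratic_Reciprocity_int) (auto)
  moreover have "s = (if p mod 4 = 3 \<and> q mod 4 = 3 then -1 else 1)"
  proof -
    have "even (nat ((p - 1) div 2 * ((q - 1) div 2))) \<longleftrightarrow> even ((p - 1) div 2 * ((q - 1) div 2))"
      using assms by (simp add: even_nat_iff)
    also have "\<dots> \<longleftrightarrow> even ((p - 1) div 2) \<or> even ((q - 1) div 2)"
      by simp
    also have "\<dots> \<longleftrightarrow> \<not> (p mod 4 = 3 \<and> q mod 4 = 3)"
      using odd by presburger
    finally show ?thesis
      unfolding s_def by (auto simp: minus_one_power_iff)
  qed
  ultimately show ?thesis
    using nz Legendre_values[of p q] Legendre_values[of q p] by (auto split: if_splits)
qed

text \<open>Two nested inductions lead down to Legendre symbols: the outer one removes a prime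
  \<open>p\<close> from \<open>m\<close>, the inner one removes primes from \<open>n\<close> while
  \<open>p\<close> is fixed.\<close>

theorem kronecker_reciprocity:
  assumes "odd m" "m > 0" "odd n" "n > 0"
  shows "kronecker m n = (if m mod 4 = 3 \<and> n mod 4 = 3 then -1 else 1) * kronecker n m"
  using assms
proof (induction m rule: odd_pos_induct)
  case one
  then show ?case by simp
next
  case (prime_mult p m)
  have odd: "odd p" using prime_mult prime_odd_int by blast
  have p: "kronecker p n = (if p mod 4 = 3 \<and> n mod 4 = 3 then -1 else 1) * kronecker n p"
    using \<open>odd n\<close> \<open>n > 0\<close>
  proof (induction n rule: odd_pos_induct)
    case one
    then show ?case using odd prime_mult.hyps by simp
  next
    case (prime_mult q n)
    have "odd q" using prime_mult prime_odd_int by blast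
    then show ?case
      using prime_mult odd \<open>prime p\<close> \<open>p > 2\<close> mod_4_mult_cases[of q n]
        Legendre_reciprocity[of p q]
      by (simp add: kronecker_mult_right kronecker_prime_right Legendre_mult)
  qed
  show ?case
    using prime_mult p odd mod_4_mult_cases[of p m]
    by (simp add: kronecker_mult_right kronecker_mult_left)
qed

text \<open>Reciprocity for \<open>n\<close> and \<open>n - 2\<close> gives \<open>(2/n) = (-1/n) (2/(n-2))\<close>.\<close>

lemma kronecker_two:
  assumes "odd n" "n > 0"
  shows "kronecker 2 n = (if n mod 8 = 1 \<or> n mod 8 = 7 then 1 else -1)"
  using assms
proof (induction "nat n" arbitrary: n rule: less_induct)
  case less
  show ?case
  proof (cases "n = 1")
    case False
    define m where "m = n - 2"
    have m: "odd m" "m > 0" "m < n" "n = m + 2"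
      using less.prems False by (auto simp: m_def) presburger
    have "kronecker 2 n = kronecker (-1 * m) n"
      by (rule kronecker_cong) (use less.prems in \<open>auto simp: m cong_iff_dvd_diff add.commute\<close>)
    also have "\<dots> = kronecker (-1) n * kronecker m n"
      using less.prems by (rule kronecker_mult_left)
    also have "kronecker m n = kronecker n m"
    proof -
      have "\<not> (m mod 4 = 3 \<and> n mod 4 = 3)"
        using m by presburger
      then show ?thesis
        using kronecker_reciprocity[of m n] m less.prems by auto
    qed
    also have "kronecker n m = kronecker 2 m"
      by (rule kronecker_cong) (use m in \<open>auto simp: cong_iff_dvd_diff\<close>)
    also have "kronecker 2 m = (if m mod 8 = 1 \<or> m mod 8 = 7 then 1 else -1)"
      using less.hyps m by auto
    finally have *: "kronecker 2 n =
        (if n mod 4 = 3 then -1 else 1) * (if m mod 8 = 1 \<or> m mod 8 = 7 then 1 else -1)"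
      using kronecker_minus_one[of n] less.prems by simp
    have "n mod 8 = 1 \<or> n mod 8 = 3 \<or> n mod 8 = 5 \<or> n mod 8 = 7"
      using less.prems(1) by presburger
    moreover have "m mod 8 = (n mod 8 + 6) mod 8"
      by (simp add: m_def mod_add_left_eq mod_eq_dvd_iff)
    moreover have "n mod 4 = (n mod 8) mod 4"
      by (simp add: mod_mod_cancel)
    ultimately show ?thesis
      using * by (elim disjE) simp_all
  qed simp
qed

text \<open>Write \<open>x = 2 ^ j * m\<close> with \<open>m\<close> odd. The shift keeps
  \<open>y\<close> modulo 4 and modulo \<open>m\<close>, so reciprocity settles the factor
  \<open>m\<close>. If \<open>j > 0\<close>, it also keeps \<open>y\<close> modulo 8, which settles
  the symbol of 2.\<close>

lemma kronecker_shift_right: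
  assumes "odd y" "y > 0" "x \<ge> 0" "k \<ge> 0"
  shows "kronecker x (y + 4 * k * x) = kronecker x y"
proof (cases "x = 0")
  case False
  then have "x > 0" using assms by simp
  have "4 * k * x \<ge> 0"
    using assms by simp
  define z where "z = y + 4 * k * x"
  have z: "odd z" "z > 0"
    using assms(1,2) \<open>4 * k * x \<ge> 0\<close> unfolding z_def by (simp, linarith)
  have two: "kronecker (2 ^ j) z = kronecker (2 ^ j) y" if "2 ^ j dvd x" for j :: nat
  proof (cases j)
    case (Suc i)
    then have "even x" using that by (auto elim: dvd_trans[rotated])
    then have "8 dvd z - y" by (auto simp: z_def)
    then have "z mod 8 = y mod 8" by (simp add: mod_eq_dvd_iff)
    then have "kronecker 2 z = kronecker 2 y"
      using z assms by (simp add: kronecker_two)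
    then show ?thesis
      by (induction j) (use z assms in \<open>simp_all add: kronecker_mult_left\<close>)
  qed (use z assms in simp)
  obtain j m where jm: "x = 2 ^ j * m" "odd m"
    using \<open>x > 0\<close> multiplicity_decompose'[of x 2] by (metis less_irrefl odd_one)
  have "m > 0"
    using jm \<open>x > 0\<close> by (simp add: zero_less_mult_iff)
  have "z mod 4 = y mod 4"
    unfolding z_def by (metis mod_mult_self2 mult.assoc)
  then have "kronecker m z = kronecker m y"
    using kronecker_reciprocity[of m z] kronecker_reciprocity[of m y] jm \<open>m > 0\<close> z assms
      kronecker_cong[of m z y]
    by (auto simp: z_def cong_iff_dvd_diff)
  then have "kronecker x z = kronecker x y"
    using two[of j] z assms jm by (simp add: kronecker_mult_left)
  then show ?thesis
    by (simp add: z_def)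
qed (simp)

subsection \<open>The orbit numerators\<close>

lemma common_prime_divisor:
  fixes a b :: int
  assumes "\<not> coprime a b" "b \<noteq> 0"
  shows "\<exists>p. prime p \<and> p dvd a \<and> p dvd b"
proof -
  have "\<not> is_unit (gcd a b)" "gcd a b \<noteq> 0"
    using assms by auto
  then obtain p where "prime p" "p dvd gcd a b"
    using prime_divisor_exists by blast
  then show ?thesis
    by auto
qed

text \<open>Let \<open>k\<close> be the product of the primes that divide \<open>x\<close> but not
  \<open>u\<close>. Every prime divisor of \<open>x\<close> then divides exactly one of
  \<open>u\<close> and \<open>k * v\<close>.\<close>

lemma exists_coprime_in_progression:
  fixes u v x :: int
  assumes "coprime u v" "x \<noteq> 0"
  shows "\<exists>k\<ge>0. coprime (u + k * v) x"
proof -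
  define S where "S = {p \<in> prime_factors x. \<not> p dvd u}"
  define k where "k = \<Prod>S"
  have S: "finite S" "\<And>p. p \<in> S \<Longrightarrow> prime p"
    by (auto simp: S_def)
  have dvd_k: "p dvd k \<longleftrightarrow> p \<in> S" if p: "prime p" for p
  proof
    assume "p dvd k"
    then obtain q where "q \<in> S" "p dvd q"
      using S p prime_dvd_prod_iff[of S p "\<lambda>q. q"] unfolding k_def by auto
    then show "p \<in> S"
      using S p primes_dvd_imp_eq by metis
  qed (use S in \<open>auto simp: k_def\<close>)
  have "coprime (u + k * v) x"
  proof (rule ccontr)
    assume "\<not> coprime (u + k * v) x"
    then obtain p where p: "prime p" "p dvd u + k * v" "p dvd x"
      using assms(2) common_prime_divisor by blast
    show False
    proof (cases "p dvd u")
      case True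
      then have "p dvd k * v"
        using p by (simp add: dvd_add_right_iff)
      moreover have "\<not> p dvd v"
        using True assms(1) p(1) by (meson coprime_common_divisor not_prime_unit)
      ultimately have "p dvd k"
        using p(1) prime_dvd_mult_iff by blast
      then show False
        using dvd_k[OF p(1)] True by (simp add: S_def)
    next
      case False
      then have "p dvd k"
        using dvd_k p assms(2) by (simp add: S_def in_prime_factors_iff)
      then show False
        using p False by (simp add: dvd_add_left_iff)
    qed
  qed
  moreover have "k \<ge> 0"
    unfolding k_def using S by (intro prod_nonneg) (auto simp: prime_ge_0_int)
  ultimately show ?thesis by blast
qed

section \<open>Invariance of the symbol under matrices with \<open>(b/a) = 1\<close>\<close>

lemma odd_if_mod_4_eq_1: "a mod 4 = 1 \<Longrightarrow> odd (a :: int)"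
  by presburger

text \<open>The first product is \<open>(b/ad)\<close> with \<open>a * d = 1 + b * c\<close>, where
  \<open>4 dvd c\<close> allows the shift down to \<open>(b/1)\<close>. The second is
  \<open>(bc/d) = (-1/d)\<close>. Hence \<open>(b/a) = 1\<close> passes on to \<open>(b/d)\<close>
  and \<open>(c/d)\<close>.\<close>

lemma kronecker_row_col:
  fixes a b c d :: int
  assumes ad: "a mod 4 = 1" "d mod 4 = 1" "4 dvd c" and nonneg: "0 \<le> a" "0 \<le> b" "0 \<le> c" "0 \<le> d"
    and det: "a * d - b * c = 1"
  shows "kronecker b a * kronecker b d = 1" "kronecker c d * kronecker b d = 1"
proof -
  have odd: "odd a" "odd d"
    using ad odd_if_mod_4_eq_1 by auto
  have pos: "a > 0" "d > 0"
    using nonneg odd by (auto simp: order_le_less)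
  obtain c' where c': "c = 4 * c'" "c' \<ge> 0"
    using ad(3) nonneg(3) by (auto elim!: dvdE)
  have "kronecker b a * kronecker b d = kronecker b (1 + 4 * c' * b)"
    using pos det c' by (simp flip: kronecker_mult_right add: algebra_simps)
  also have "\<dots> = kronecker b 1"
    by (rule kronecker_shift_right) (use c' nonneg in auto)
  finally show "kronecker b a * kronecker b d = 1"
    by simp
  have "kronecker c d * kronecker b d = kronecker (-1) d"
    unfolding kronecker_mult_left[OF odd(2) pos(2), symmetric]
  proof (rule kronecker_cong)
    have "c * b - (-1) = d * a"
      using det by (simp add: algebra_simps)
    then show "[c * b = -1] (mod d)"
      by (simp add: cong_iff_dvd_diff)
  qed (use odd pos in auto)
  then show "kronecker c d * kronecker b d = 1"
    using kronecker_minus_one[of d] odd pos ad by simp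
qed

text \<open>Let \<open>X\<close> and \<open>Y\<close> be the new coordinates. Since
  \<open>d * X = x + b * Y\<close>, we get \<open>(d/Y) (X/Y) = (x/Y)\<close>. Shifting turns
  \<open>(x/Y)\<close> into \<open>(x/d) (x/y)\<close>, and reciprocity turns \<open>(d/Y)\<close>
  into \<open>(cx/d) = (x/d)\<close>. Coprimality of \<open>x\<close> and \<open>d\<close> permits
  cancelling \<open>(x/d)\<close>.\<close>

lemma kronecker_action_coprime:
  fixes a b c d x y :: int
  assumes ad: "a mod 4 = 1" "d mod 4 = 1" "4 dvd c" and nonneg: "0 \<le> a" "0 \<le> b" "0 \<le> c" "0 \<le> d"
    and det: "a * d - b * c = 1" and ba: "kronecker b a = 1"
    and xy: "0 \<le> x" "0 < y" "odd y" and cop: "coprime x d"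
  shows "kronecker (a * x + b * y) (c * x + d * y) = kronecker x y"
proof -
  define X Y where "X = a * x + b * y" and "Y = c * x + d * y"
  have odd: "odd d"
    using ad odd_if_mod_4_eq_1 by auto
  have pos: "d > 0"
    using nonneg odd by (auto simp: order_le_less)
  obtain c' where c': "c = 4 * c'" "c' \<ge> 0"
    using ad(3) nonneg(3) by (auto elim!: dvdE)
  have "0 < d * y" "0 \<le> c * x"
    using pos xy nonneg by auto
  then have Y: "odd Y" "Y > 0"
    unfolding Y_def using odd xy c' by (simp, linarith)
  have cd: "kronecker c d = 1"
    using kronecker_row_col[OF ad nonneg det] ba by auto
  have dX: "d * X - x = b * Y"
  proof -
    have "d * X - x = (a * d - b * c - 1) * x + b * Y"
      by (simp add: X_def Y_def algebra_simps)
    then show ?thesis using det by simp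
  qed
  have "kronecker d Y * kronecker X Y = kronecker x Y"
    unfolding kronecker_mult_left[OF Y, symmetric]
    by (rule kronecker_cong[OF Y]) (simp add: cong_iff_dvd_diff dX)
  also have "kronecker x Y = kronecker x (d * y + 4 * c' * x)"
    by (simp add: Y_def c' add.commute)
  also have "\<dots> = kronecker x (d * y)"
    by (rule kronecker_shift_right) (use odd xy c' pos in auto)
  also have "\<dots> = kronecker x d * kronecker x y"
    using pos xy by (simp add: kronecker_mult_right)
  also have "kronecker d Y = kronecker Y d"
    using kronecker_reciprocity[of d Y] odd pos Y ad by simp
  also have "kronecker Y d = kronecker (c * x) d"
    by (rule kronecker_cong) (use odd pos in \<open>auto simp: Y_def cong_iff_dvd_diff\<close>)
  also have "\<dots> = kronecker x d"
    using cd odd pos by (simp add: kronecker_mult_left)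
  finally have "kronecker x d * kronecker X Y = kronecker x d * kronecker x y" .
  moreover have "kronecker x d \<noteq> 0"
    using cop odd pos by (simp add: kronecker_eq_0_iff)
  ultimately show ?thesis
    by (simp add: X_def Y_def)
qed

text \<open>Adding \<open>4 * k\<close> times the upper row to the lower row changes
  \<open>Y\<close> to \<open>Y + 4 * k * X\<close>, which leaves \<open>(X/Y)\<close> alone, and a
  suitable \<open>k\<close> makes the new \<open>d\<close> coprime to \<open>x\<close>. For
  \<open>x = 0\<close> both symbols vanish unless \<open>y = 1\<close>, where
  \<open>(b/d) = 1\<close> is needed.\<close>

lemma kronecker_action:
  fixes a b c d x y :: int
  assumes ad: "a mod 4 = 1" "d mod 4 = 1" "4 dvd c" and nonneg: "0 \<le> a" "0 \<le> b" "0 \<le> c" "0 \<le> d"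
    and det: "a * d - b * c = 1" and ba: "kronecker b a = 1"
    and xy: "0 \<le> x" "0 \<le> y" "odd y"
  shows "kronecker (a * x + b * y) (c * x + d * y) = kronecker x y"
proof (cases "x = 0")
  case True
  have odd: "odd d"
    using ad odd_if_mod_4_eq_1 by auto
  have pos: "d > 0" "y > 0"
    using nonneg odd xy by (auto simp: order_le_less)
  have bd: "kronecker b d = 1"
    using kronecker_row_col[OF ad nonneg det] ba by auto
  show ?thesis
  proof (cases "y = 1")
    case True
    then show ?thesis using \<open>x = 0\<close> bd by simp
  next
    case False
    then have "\<not> coprime (b * y) y" "\<not> coprime 0 y"
      using pos by auto
    then have "kronecker (b * y) y = 0" "kronecker 0 y = 0"
      using kronecker_eq_0_iff xy pos by blast+
    then show ?thesis
      using \<open>x = 0\<close> pos by (simp add: kronecker_mult_right)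
  qed
next
  case False
  have odd: "odd d"
    using ad odd_if_mod_4_eq_1 by auto
  have pos: "d > 0" "y > 0"
    using nonneg odd xy by (auto simp: order_le_less)
  have "coprime d (4 * b)"
  proof -
    have "coprime d b"
      using det by (intro coprimeI) (metis dvd_diff dvd_mult dvd_mult2)
    moreover have "coprime d (2 * 2)"
      using odd by (simp only: coprime_mult_right_iff coprime_right_2_iff_odd simp_thms)
    ultimately show ?thesis by simp
  qed
  then obtain k where k: "k \<ge> 0" "coprime (d + k * (4 * b)) x"
    using exists_coprime_in_progression False by blast
  define X Y where "X = a * x + b * y" and "Y = c * x + d * y"
  define c' d' where "c' = c + 4 * k * a" and "d' = d + 4 * k * b"
  have "d' mod 4 = 1"
    using ad by (simp add: d'_def mult.assoc)
  moreover have "4 dvd c'"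
    using ad by (simp add: c'_def)
  moreover have "a * d' - b * c' = 1"
    using det by (simp add: c'_def d'_def algebra_simps)
  moreover have "0 \<le> c'" "0 \<le> d'"
    using nonneg k by (auto simp: c'_def d'_def)
  moreover have "coprime x d'"
    using k by (simp add: d'_def coprime_commute mult_ac)
  ultimately have "kronecker X (c' * x + d' * y) = kronecker x y"
    unfolding X_def using kronecker_action_coprime ad nonneg ba xy pos by blast
  also have "c' * x + d' * y = Y + 4 * k * X"
    by (simp add: X_def Y_def c'_def d'_def algebra_simps)
  also have "kronecker X (Y + 4 * k * X) = kronecker X Y"
  proof (rule kronecker_shift_right)
    have "0 < d * y" "0 \<le> c * x"
      using pos xy nonneg by auto
    then show "odd Y" "Y > 0"
      using odd xy ad(3) by (auto simp: Y_def elim!: dvdE)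
    show "X \<ge> 0"
      using nonneg xy by (simp add: X_def)
  qed (use k in simp)
  finally show ?thesis
    by (simp add: X_def Y_def)
qed

text \<open>The entry \<open>(b/a)\<close> of the top row of \<open>\<gamma> \<in> \<Gamma>\<^sub>1(4)\<close> alone decides whether \<open>\<gamma> \<in> \<Psi>\<close>.\<close>

definition orbit_numerator :: "int \<Rightarrow> bool" where
  "orbit_numerator n \<longleftrightarrow>
     (\<exists>a b. a > 0 \<and> a mod 4 = 1 \<and> b \<ge> 0 \<and> kronecker b a = 1 \<and> n = 2 * a + 3 * b)"

lemma orbit_numeratorI:
  assumes "a > 0" "a mod 4 = 1" "b \<ge> 0" "kronecker b a = 1" "n = 2 * a + 3 * b"
  shows "orbit_numerator n"
  using assms unfolding orbit_numerator_def by blast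

lemma mem_Gamma1_4_nonneg_iff:
  "\<gamma> \<in> Gamma1_4_nonneg \<longleftrightarrow>
     \<gamma> $ 1 $ 1 mod 4 = 1 \<and> \<gamma> $ 2 $ 2 mod 4 = 1 \<and> 4 dvd \<gamma> $ 2 $ 1 \<and>
     0 \<le> \<gamma> $ 1 $ 1 \<and> 0 \<le> \<gamma> $ 1 $ 2 \<and> 0 \<le> \<gamma> $ 2 $ 1 \<and> 0 \<le> \<gamma> $ 2 $ 2 \<and>
     \<gamma> $ 1 $ 1 * \<gamma> $ 2 $ 2 - \<gamma> $ 1 $ 2 * \<gamma> $ 2 $ 1 = 1"
  by (auto simp: Gamma1_4_nonneg_def det_2 forall_2 cong_def)

lemma numerators_Psi_orbit:
  "n \<in> numerators (Psi_orbit (vector [2, 3])) \<longleftrightarrow>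
     (\<exists>\<gamma>\<in>Psi. n = 2 * \<gamma> $ 1 $ 1 + 3 * \<gamma> $ 1 $ 2)"
proof -
  have "(\<gamma> *v vector [2, 3]) $ 1 = 2 * \<gamma> $ 1 $ 1 + 3 * \<gamma> $ 1 $ 2" for \<gamma> :: "int ^ 2 ^ 2"
    by (simp add: matrix_vector_mult_def sum_2)
  then show ?thesis
    by (simp add: numerators_def Psi_orbit_def) metis
qed

theorem numerators_Psi_orbit_iff:
  "n \<in> numerators (Psi_orbit (vector [2, 3])) \<longleftrightarrow> orbit_numerator n"
proof
  assume "n \<in> numerators (Psi_orbit (vector [2, 3]))"
  then obtain \<gamma> where \<gamma>: "\<gamma> \<in> Psi" "n = 2 * \<gamma> $ 1 $ 1 + 3 * \<gamma> $ 1 $ 2"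
    unfolding numerators_Psi_orbit by blast
  have G: "\<gamma> \<in> Gamma1_4_nonneg"
    using \<gamma> by (simp add: Psi_def)
  note G' = G[unfolded mem_Gamma1_4_nonneg_iff]
  have "\<forall>x y. 0 \<le> x \<longrightarrow> 0 \<le> y \<longrightarrow> odd y \<longrightarrow> kronecker x y =
      kronecker (\<gamma> $ 1 $ 1 * x + \<gamma> $ 1 $ 2 * y) (\<gamma> $ 2 $ 1 * x + \<gamma> $ 2 $ 2 * y)"
    using \<gamma>(1) unfolding Psi_def by blast
  \<comment> \<open>The vector (0, 1) is mapped to \<open>(b, d)\<close>, so invariance there says
    \<open>(b/d) = 1\<close>.\<close>
  from this[rule_format, of 0 1] have "kronecker (\<gamma> $ 1 $ 2) (\<gamma> $ 2 $ 2) = 1"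
    by simp
  then have "kronecker (\<gamma> $ 1 $ 2) (\<gamma> $ 1 $ 1) = 1"
    using kronecker_row_col(1)[of "\<gamma> $ 1 $ 1" "\<gamma> $ 2 $ 2" "\<gamma> $ 2 $ 1" "\<gamma> $ 1 $ 2"] G' by auto
  moreover have "\<gamma> $ 1 $ 1 > 0"
    using G' by (cases "\<gamma> $ 1 $ 1 = 0") auto
  ultimately show "orbit_numerator n"
    using \<gamma>(2) G' by (intro orbit_numeratorI[of "\<gamma> $ 1 $ 1" "\<gamma> $ 1 $ 2"]) auto
next
  assume "orbit_numerator n"
  then obtain a b where ab: "a > 0" "a mod 4 = 1" "b \<ge> 0" "kronecker b a = 1" "n = 2 * a + 3 * b"
    unfolding orbit_numerator_def by blast
  have "odd a"
    using ab odd_if_mod_4_eq_1 by auto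
  then have "coprime b a"
    using kronecker_eq_0_iff[of a b] ab by auto
  moreover have "coprime (2 * 2) a"
    using \<open>odd a\<close> by (simp only: coprime_mult_left_iff coprime_left_2_iff_odd simp_thms)
  ultimately have cop: "coprime (4 * b) a"
    by simp
  \<comment> \<open>The top row is completed to a matrix: \<open>c\<close> is minus the inverse of
    \<open>4 * b\<close> modulo \<open>a\<close>, and the determinant then forces
    \<open>d\<close>.\<close>
  obtain d c where dc: "a * d - b * (4 * c) = 1" "c \<ge> 0" "d \<ge> 0"
  proof -
    obtain u where u: "[4 * b * u = 1] (mod a)"
      using cong_solve_coprime_int[OF cop] by auto
    define c where "c = (- u) mod a"
    have "c \<ge> 0"
      using ab by (simp add: c_def)
    have "[4 * b * c = 4 * b * (- u)] (mod a)"
      unfolding c_def by (intro cong_mult cong_refl) (simp add: cong_def)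
    also have "[4 * b * (- u) = - 1] (mod a)"
      using cong_minus_minus_iff[of "4 * b * u" 1 a] u by simp
    finally have "a dvd 4 * b * c + 1"
      by (simp add: cong_iff_dvd_diff)
    then obtain d where d: "4 * b * c + 1 = a * d"
      by (elim dvdE)
    have "a * d > 0"
      unfolding d[symmetric] using ab \<open>c \<ge> 0\<close> by (simp add: add_nonneg_pos)
    then have "d \<ge> 0"
      using ab by (simp add: zero_less_mult_iff)
    then show ?thesis
      using that[of d c] d \<open>c \<ge> 0\<close> by (simp add: algebra_simps)
  qed
  define \<gamma> :: "int ^ 2 ^ 2" where "\<gamma> = vector [vector [a, b], vector [4 * c, d]]"
  have \<gamma>: "\<gamma> $ 1 $ 1 = a" "\<gamma> $ 1 $ 2 = b" "\<gamma> $ 2 $ 1 = 4 * c" "\<gamma> $ 2 $ 2 = d"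
    by (simp_all add: \<gamma>_def vector_2)
  have "d mod 4 = 1"
  proof -
    have "(a * d) mod 4 = (1 + 4 * (b * c)) mod 4"
      using dc by (simp add: algebra_simps)
    also have "\<dots> = 1"
      by simp
    also have "(a * d) mod 4 = ((a mod 4) * (d mod 4)) mod 4"
      by (simp only: mod_mult_eq)
    finally show ?thesis
      using ab by simp
  qed
  then have "\<gamma> \<in> Psi"
    unfolding Psi_def mem_Collect_eq mem_Gamma1_4_nonneg_iff \<gamma>
    using ab dc kronecker_action[of a d "4 * c" b] by auto
  then show "n \<in> numerators (Psi_orbit (vector [2, 3]))"
    unfolding numerators_Psi_orbit using ab \<gamma> by auto
qed

text \<open>The reciprocity obstruction: \<open>(2/3) = -1\<close> is inherited by the whole orbit.\<close>

lemma square_not_orbit_numerator: "\<not> orbit_numerator (m\<^sup>2)"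
proof
  assume "orbit_numerator (m\<^sup>2)"
  then obtain \<gamma> where \<gamma>: "\<gamma> \<in> Psi" "m\<^sup>2 = 2 * \<gamma> $ 1 $ 1 + 3 * \<gamma> $ 1 $ 2"
    unfolding numerators_Psi_orbit_iff[symmetric] numerators_Psi_orbit by blast
  define Y where "Y = \<gamma> $ 2 $ 1 * 2 + \<gamma> $ 2 $ 2 * 3"
  have G: "\<gamma> \<in> Gamma1_4_nonneg"
    using \<gamma> by (simp add: Psi_def)
  note G' = G[unfolded mem_Gamma1_4_nonneg_iff]
  have "odd (\<gamma> $ 2 $ 2)"
    using G' odd_if_mod_4_eq_1 by blast
  then have Y: "odd Y" "Y > 0"
    using G' by (auto simp: Y_def) (smt (verit) dvd_0_right)
  have "kronecker 2 3 = kronecker (\<gamma> $ 1 $ 1 * 2 + \<gamma> $ 1 $ 2 * 3) Y"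
    using \<gamma>(1) unfolding Psi_def Y_def by auto
  then have "kronecker (m\<^sup>2) Y = kronecker 2 3"
    using \<gamma>(2) by (simp add: mult.commute)
  also have "kronecker 2 3 = -1"
    by (simp add: kronecker_two)
  finally show False
    using kronecker_square_left[OF Y, of m] by (auto split: if_splits)
qed

subsection \<open>Explicit families of numerators\<close>

text \<open>The choice \<open>a = 1\<close> works, where every symbol is 1.\<close>

lemma orbit_numerator_mod_3_eq_2:
  assumes "n mod 3 = 2" "n > 0"
  shows "orbit_numerator n"
proof (rule orbit_numeratorI[of 1 "(n - 2) div 3"])
  show "n = 2 * 1 + 3 * ((n - 2) div 3)"
    using assms by presburger
  show "(n - 2) div 3 \<ge> 0"
    using assms by presburger
qed auto

text \<open>For \<open>a = 9\<close> the symbol is a square of one modulo 3, so it is 1 as soon as 3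
  does not divide \<open>b\<close>.\<close>

lemma orbit_numerator_3_mult:
  assumes "\<not> 3 dvd m" "m \<ge> 6"
  shows "orbit_numerator (3 * m)"
proof (rule orbit_numeratorI[of 9 "m - 6"])
  have "coprime 3 (m - 6)"
    using assms(1) by (intro prime_imp_coprime) (auto, presburger)
  then have "kronecker (m - 6) 3 \<noteq> 0"
    by (simp add: kronecker_eq_0_iff coprime_commute)
  then have "kronecker (m - 6) 3 = 1 \<or> kronecker (m - 6) 3 = -1"
    using kronecker_values[of 3 "m - 6"] by auto
  then show "kronecker (m - 6) 9 = 1"
    using kronecker_mult_right[of 3 3 "m - 6"] by auto
qed (use assms in auto)

text \<open>A power of 4 is a square coprime to every odd \<open>a\<close>. The values 1, 4 and 16
  of \<open>b\<close> produce the classes 5, 6 and 2 modulo 8.\<close>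

lemma orbit_numerator_square_coefficient:
  assumes "n = 2 * a + 3 * (2 ^ k)\<^sup>2" "a > 0" "a mod 4 = 1"
  shows "orbit_numerator n"
proof (rule orbit_numeratorI[OF assms(2,3) _ _ assms(1)])
  have "odd a"
    using assms odd_if_mod_4_eq_1 by blast
  then show "kronecker ((2 ^ k)\<^sup>2) a = 1"
    using assms by (subst kronecker_square_left) (auto simp: coprime_power_left_iff)
qed simp

lemma orbit_numerator_mod_8_eq_5:
  assumes "n mod 8 = 5" "n > 0"
  shows "orbit_numerator n"
proof (rule orbit_numerator_square_coefficient[of n "(n - 3) div 2" 0])
  show "n = 2 * ((n - 3) div 2) + 3 * (2 ^ 0)\<^sup>2" "(n - 3) div 2 > 0" "(n - 3) div 2 mod 4 = 1"
    using assms by (simp_all, presburger+)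
qed

lemma orbit_numerator_mod_8_eq_6:
  assumes "n mod 8 = 6" "n \<ge> 14"
  shows "orbit_numerator n"
proof (rule orbit_numerator_square_coefficient[of n "(n - 12) div 2" 1])
  show "n = 2 * ((n - 12) div 2) + 3 * (2 ^ 1)\<^sup>2" "(n - 12) div 2 > 0" "(n - 12) div 2 mod 4 = 1"
    using assms by (simp_all, presburger+)
qed

lemma orbit_numerator_mod_8_eq_2:
  assumes "n mod 8 = 2" "n \<ge> 50"
  shows "orbit_numerator n"
proof (rule orbit_numerator_square_coefficient[of n "(n - 48) div 2" 2])
  show "n = 2 * ((n - 48) div 2) + 3 * (2 ^ 2)\<^sup>2" "(n - 48) div 2 > 0" "(n - 48) div 2 mod 4 = 1"
    using assms by (simp_all, presburger+)
qed

text \<open>Keep \<open>a\<close> and replace \<open>b\<close> by \<open>4 * b + 2 * a\<close>,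
  which is \<open>4 * b\<close> modulo \<open>a\<close>.\<close>

lemma orbit_numerator_4_mult:
  assumes "orbit_numerator n"
  shows "orbit_numerator (4 * n)"
proof -
  obtain a b where ab: "a > 0" "a mod 4 = 1" "b \<ge> 0" "kronecker b a = 1" "n = 2 * a + 3 * b"
    using assms unfolding orbit_numerator_def by blast
  have "odd a"
    using ab odd_if_mod_4_eq_1 by blast
  have "kronecker (4 * b + 2 * a) a = kronecker (2\<^sup>2 * b) a"
    by (rule kronecker_cong) (use ab \<open>odd a\<close> in \<open>auto simp: cong_iff_dvd_diff\<close>)
  also have "\<dots> = 1"
    using ab \<open>odd a\<close> kronecker_square_left[of a 2]
    by (simp add: kronecker_mult_left)
  finally show ?thesis
    using ab by (intro orbit_numeratorI[of a "4 * b + 2 * a"]) auto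
qed

text \<open>Modulo \<open>a\<close> we have \<open>n = 3 * b\<close>, and
  \<open>(3/a) = (a/3) = (2/3) = -1\<close> for \<open>a\<close> congruent to 5 modulo 12. Thus
  \<open>(b/a) = -(n/a)\<close>, a condition on \<open>n\<close> and \<open>a\<close> alone.\<close>

lemma orbit_numerator_mod_3_eq_1:
  assumes "n mod 3 = 1" "a mod 12 = 5" "0 < a" "2 * a \<le> n" "kronecker n a = -1"
  shows "orbit_numerator n"
proof -
  have a: "a mod 4 = 1" "a mod 3 = 2" "odd a"
    using assms(2) by presburger+
  define b where "b = (n - 2 * a) div 3"
  have "(n - 2 * a) mod 3 = 0"
    using assms(1) a(2) by presburger
  then have b: "n = 2 * a + 3 * b"
    unfolding b_def by presburger
  have "kronecker 3 a = kronecker a 3"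
    using kronecker_reciprocity[of 3 a] a assms by simp
  also have "\<dots> = kronecker 2 3"
    using a by (intro kronecker_cong) (auto simp: cong_def)
  also have "\<dots> = -1"
    by (simp add: kronecker_two)
  finally have "kronecker 3 a = -1" .
  moreover have "kronecker n a = kronecker (3 * b) a"
    using a assms b by (intro kronecker_cong) (auto simp: cong_iff_dvd_diff)
  ultimately have "kronecker b a = 1"
    using assms a by (simp add: kronecker_mult_left)
  then show ?thesis
    using assms a b by (intro orbit_numeratorI[of a b]) auto
qed

text \<open>The top left entry is \<open>3 * a\<close>, with \<open>b = n / 3 - 2 * a\<close>.
  Modulo 3 this \<open>b\<close> is \<open>a\<close>, and modulo \<open>a\<close> it is
  \<open>n / 3\<close>, so \<open>(b/3a) = (a/3) (3/a) (n/a)\<close>. The first two factors have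
  product -1 because 3 and \<open>a\<close> are both 3 modulo 4.\<close>

lemma orbit_numerator_9_dvd:
  assumes "9 dvd n" "a mod 4 = 3" "\<not> 3 dvd a" "0 < a" "6 * a \<le> n" "kronecker n a = -1"
  shows "orbit_numerator n"
proof -
  have "odd a"
    using assms(2) by presburger
  obtain m where m: "n = 9 * m"
    using assms(1) by (elim dvdE)
  define b where "b = 3 * m - 2 * a"
  have "kronecker b 3 = kronecker a 3"
    by (rule kronecker_cong) (auto simp: b_def cong_iff_dvd_diff)
  moreover have "kronecker 3 a = - kronecker a 3"
    using kronecker_reciprocity[of 3 a] \<open>odd a\<close> assms by simp
  moreover have "kronecker b a = kronecker (3 * m) a"
    using \<open>odd a\<close> assms by (intro kronecker_cong) (auto simp: b_def cong_iff_dvd_diff)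
  moreover have "kronecker n a = kronecker 3 a * kronecker (3 * m) a"
    using kronecker_mult_left[of a 3 "3 * m"] \<open>odd a\<close> assms by (simp add: m)
  moreover have "kronecker a 3 * kronecker a 3 = 1"
  proof -
    have "coprime 3 a"
      using assms by (intro prime_imp_coprime) auto
    then have "kronecker a 3 \<noteq> 0"
      by (simp add: kronecker_eq_0_iff coprime_commute)
    then show ?thesis
      using kronecker_values[of 3 a] by auto
  qed
  ultimately have "kronecker b (3 * a) = 1"
    using \<open>odd a\<close> assms by (simp add: kronecker_mult_right)
  moreover have "3 * a mod 4 = 1"
    using assms(2) by presburger
  ultimately show ?thesis
    using assms m by (intro orbit_numeratorI[of "3 * a" b]) (auto simp: b_def)
qed

text \<open>
  For \<open>b\<close> in the residue class \<open>3 (n - 2)\<close> modulo \<open>8\<close>, the symbol \<open>(b/a)\<close> with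
  \<open>a = (n - 3 b) / 2\<close> agrees with \<open>(b/n)\<close> up to a sign that does not depend on \<open>b\<close>. So it suffices
  to find two such \<open>b\<close> at which \<open>(b/n)\<close> takes opposite values.
\<close>

lemma kronecker_numerator_pair:
  assumes "odd n" "0 < b" "3 * b + 2 \<le> n" "[b = 3 * (n - 2)] (mod 8)"
  shows "\<exists>a>0. a mod 4 = 1 \<and> n = 2 * a + 3 * b \<and>
           kronecker b a = kronecker 2 b * (if n mod 4 = 3 \<and> b mod 4 = 3 then -1 else 1) * kronecker b n"
proof -
  obtain j where j: "b = 3 * (n - 2) + 8 * j"
    using assms(4) by (metis cong_iff_lin cong_sym mult.commute)
  \<comment> \<open>This is \<open>(n - 3 * b) / 2\<close> written out; the residue class of
    \<open>b\<close> is the one that makes it 1 modulo 4.\<close>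
  define a where "a = 9 - 4 * n - 12 * j"
  have n: "n = 2 * a + 3 * b"
    by (simp add: a_def j)
  have "a > 0" "n > 0"
    using n assms by auto
  have a: "a mod 4 = 1" "odd a"
    unfolding a_def by presburger+
  have "odd b"
    using assms(1) j by simp
  have "kronecker b a = kronecker a b"
    using kronecker_reciprocity[of b a] a \<open>odd b\<close> \<open>a > 0\<close> assms by simp
  \<comment> \<open>The square factor 4 is inserted because \<open>4 * a = 2 * n - 6 * b\<close>,
    which is \<open>2 * n\<close> modulo \<open>b\<close>.\<close>
  also have "\<dots> = kronecker (2\<^sup>2 * a) b"
    using \<open>odd b\<close> assms kronecker_mult_left[of b "2\<^sup>2" a] kronecker_square_left[of b 2] by simp
  also have "\<dots> = kronecker (2 * n) b"
    using \<open>odd b\<close> assms by (intro kronecker_cong) (auto simp: n cong_iff_dvd_diff)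
  also have "\<dots> = kronecker 2 b * kronecker n b"
    using \<open>odd b\<close> assms by (intro kronecker_mult_left)
  also have "kronecker n b = (if n mod 4 = 3 \<and> b mod 4 = 3 then -1 else 1) * kronecker b n"
    using kronecker_reciprocity[of n b] assms \<open>odd b\<close> \<open>n > 0\<close> by simp
  finally show ?thesis
    using a n \<open>a > 0\<close> by (intro exI[of _ a]) auto
qed

lemma orbit_numerator_opposite_signs:
  assumes n: "odd n"
    and b: "0 < b" "3 * b + 2 \<le> n" "[b = 3 * (n - 2)] (mod 8)"
    and c: "0 < c" "3 * c + 2 \<le> n" "[c = 3 * (n - 2)] (mod 8)"
    and sgn: "kronecker b n * kronecker c n = -1"
  shows "orbit_numerator n"
proof -
  define s where "s = (\<lambda>b. kronecker 2 b * (if n mod 4 = 3 \<and> b mod 4 = 3 then -1 else 1))"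
  obtain a where a: "a > 0" "a mod 4 = 1" "n = 2 * a + 3 * b" "kronecker b a = s b * kronecker b n"
    using kronecker_numerator_pair[OF n b] by (auto simp: s_def)
  obtain d where d: "d > 0" "d mod 4 = 1" "n = 2 * d + 3 * c" "kronecker c d = s c * kronecker c n"
    using kronecker_numerator_pair[OF n c] by (auto simp: s_def)
  have eq: "b mod 8 = c mod 8"
    using b c by (simp add: cong_def)
  then have "b mod 4 = c mod 4"
    by (metis mod_mod_cancel dvd_triv_left numeral_Bit0 mult_2 mult.commute)
  have "odd b" "odd c"
    using n by (simp add: a(3), simp add: d(3))
  then have "s b = s c" and "s c \<in> {1, -1}"
    using eq \<open>b mod 4 = c mod 4\<close> b c by (simp_all add: s_def kronecker_two)
  moreover have "n > 0"
    using b by simp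
  then have "kronecker b n \<in> {1, -1}" "kronecker c n \<in> {1, -1}"
    using sgn kronecker_values[of n b] kronecker_values[of n c] n by auto
  ultimately have "kronecker b a = 1 \<or> kronecker c d = 1"
    using a(4) d(4) sgn by auto
  then show ?thesis
    using orbit_numeratorI[of a b n] orbit_numeratorI[of d c n] a d b c by auto
qed

subsection \<open>Symbols of both signs\<close>

text \<open>Some prime has odd exponent in a nonsquare. At that prime the symbol takes both signs,
  whereas even exponents contribute only 0 or 1.\<close>

lemma nonsquare_decompose:
  fixes f :: int
  assumes "odd f" "f > 0" "\<not> is_square f"
  shows "\<exists>p e g. prime p \<and> p > 2 \<and> odd e \<and> f = p ^ e * g \<and> \<not> p dvd g \<and> odd g \<and> g > 0"
proof -
  have "\<not> is_square (normalize f)"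
    using assms by simp
  then obtain p where p: "prime p" "odd (multiplicity p f)"
    using is_nth_power_conv_multiplicity[of 2 f] by auto
  define e where "e = multiplicity p f"
  obtain g where g: "f = p ^ e * g" "\<not> p dvd g"
    unfolding e_def using multiplicity_decompose'[of f p] assms p
    by (metis less_irrefl not_prime_unit)
  have "odd g"
    using g assms by auto
  have "odd (p ^ e)"
    using g(1) assms(1) by (metis even_mult_iff)
  then have "odd p"
    using p(2) odd_pos[OF p(2)] by (simp add: e_def)
  then have "p > 2"
    using prime_ge_2_int[OF p(1)] by (cases "p = 2") auto
  moreover have "g > 0"
    using g(1) assms(2) \<open>p > 2\<close> by (simp add: zero_less_mult_iff)
  ultimately show ?thesis
    using p g \<open>odd g\<close> unfolding e_def by blast
qed

lemma kronecker_power_right: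
  assumes "p > 0"
  shows "kronecker a (p ^ e) = kronecker a p ^ e"
  by (induction e) (use assms in \<open>simp_all add: kronecker_mult_right\<close>)

lemma kronecker_odd_power_right:
  assumes "odd p" "p > 0" "odd e"
  shows "kronecker a (p ^ e) = kronecker a p"
  using kronecker_values[OF assms(1,2), of a] assms
  by (auto simp: kronecker_power_right odd_pos)

text \<open>Otherwise squaring would map the nonzero residues onto themselves and so be injective,
  although 1 and \<open>p - 1\<close> have the same square.\<close>

lemma exists_nonresidue:
  assumes "prime p" "p > 2"
  shows "\<exists>a. 0 < a \<and> a < p \<and> kronecker a p = -1"
proof (rule ccontr)
  assume *: "\<not> ?thesis"
  have "odd p"
    using assms prime_odd_int by blast
  define S where "S = {0<..<p}"
  define f where "f = (\<lambda>x. x\<^sup>2 mod p)"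
  have "S \<subseteq> f ` S"
  proof
    fix a assume a: "a \<in> S"
    have "\<not> p dvd a"
      using a zdvd_not_zless by (auto simp: S_def)
    moreover have "Legendre a p \<noteq> -1"
      using * a assms by (auto simp: S_def kronecker_prime_right)
    ultimately have "QuadRes p a"
      by (auto simp: Legendre_def cong_0_iff split: if_splits)
    then obtain y where y: "[y\<^sup>2 = a] (mod p)"
      by (auto simp: QuadRes_def)
    have "(y mod p)\<^sup>2 mod p = a"
      using y a by (simp add: cong_def power_mod S_def)
    moreover from this have "y mod p \<noteq> 0"
      using a by (auto simp: S_def)
    then have "y mod p \<in> S"
      using assms pos_mod_sign[of p y] by (auto simp: S_def order_le_less)
    ultimately show "a \<in> f ` S"
      unfolding f_def by (metis imageI)
  qed
  moreover have "finite S"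
    by (simp add: S_def)
  ultimately have "inj_on f S"
    by (meson eq_card_imp_inj_on card_image_le card_mono finite_imageI order_antisym)
  moreover have "f 1 = f (p - 1)"
  proof -
    have "(p - 1)\<^sup>2 - 1 = p * (p - 2)"
      by (simp add: power2_eq_square algebra_simps)
    then have "(p - 1)\<^sup>2 mod p = 1 mod p"
      by (simp only: mod_eq_dvd_iff dvd_triv_left)
    then show ?thesis
      by (simp add: f_def)
  qed
  moreover have "1 \<in> S" "p - 1 \<in> S"
    using assms by (auto simp: S_def)
  ultimately show False
    using assms by (auto dest!: inj_onD)
qed

text \<open>Let \<open>q\<close> be the least nonresidue and \<open>k * q\<close> its first multiple
  beyond \<open>p\<close>. The remainder \<open>k * q - p\<close> is below \<open>q\<close>, hence a
  residue, so \<open>k\<close> is a nonresidue and \<open>k \<ge> q\<close>. Then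
  \<open>q * (q - 1) \<le> (k - 1) * q < p\<close>.\<close>

lemma least_nonresidue:
  assumes "prime p" "p > 2"
  obtains q where "1 < q" "kronecker q p = -1" "\<And>x. 0 < x \<Longrightarrow> x < q \<Longrightarrow> kronecker x p = 1"
    "q * (q - 1) < p"
proof -
  have odd: "odd p"
    using assms prime_odd_int by blast
  define P where "P = (\<lambda>m. m > 0 \<and> kronecker (int m) p = -1)"
  obtain a where a: "0 < a" "a < p" "kronecker a p = -1"
    using exists_nonresidue[OF assms] by blast
  then have Pa: "P (nat a)"
    by (simp add: P_def)
  define m where "m = (LEAST m. P m)"
  define q where "q = int m"
  have "P m"
    unfolding m_def using Pa by (rule LeastI)
  then have q: "q > 0" "kronecker q p = -1"
    by (auto simp: P_def q_def)
  have "m \<le> nat a"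
    unfolding m_def using Pa by (rule Least_le)
  then have "q < p"
    using a by (simp add: q_def)
  have least: "kronecker x p \<noteq> -1" if "0 < x" "x < q" for x
  proof
    assume "kronecker x p = -1"
    then have "P (nat x)"
      using that by (simp add: P_def)
    then have "m \<le> nat x"
      unfolding m_def by (rule Least_le)
    then show False
      using that by (simp add: q_def)
  qed
  have nonzero: "kronecker x p \<noteq> 0" if "0 < x" "x < p" for x
    using that assms odd by (subst kronecker_eq_0_iff)
      (auto simp: coprime_commute intro!: prime_imp_coprime dest: zdvd_not_zless)
  have below: "kronecker x p = 1" if "0 < x" "x < q" for x
    using least[OF that] nonzero[of x] that \<open>q < p\<close> kronecker_values[of p x] odd assms by auto
  have "q \<noteq> 1"
    using q(2) odd assms by auto
  then have "1 < q"
    using q by simp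
  define k where "k = p div q + 1"
  have "p div q \<ge> 0"
    using q assms by (simp add: pos_imp_zdiv_nonneg_iff)
  then have k: "0 < k" "k * q - p = q - p mod q"
    using div_mult_mod_eq[of p q] by (simp_all add: k_def algebra_simps)
  have "\<not> q dvd p"
    using assms(1) \<open>1 < q\<close> \<open>q < p\<close> by (auto simp: prime_int_iff dest!: spec[of _ q])
  then have "0 < p mod q" "p mod q < q"
    using q pos_mod_sign[of q p] by (simp_all add: dvd_eq_mod_eq_0 order_le_less)
  then have "0 < k * q - p" "k * q - p < q"
    unfolding k by auto
  then have "kronecker (k * q - p) p = 1"
    by (rule below)
  also have "kronecker (k * q - p) p = kronecker (k * q) p"
    using odd assms by (intro kronecker_cong) (auto simp: cong_iff_dvd_diff)
  also have "\<dots> = - kronecker k p"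
    using odd assms q by (simp add: kronecker_mult_left)
  finally have "\<not> k < q"
    using below[of k] k by auto
  then have "q * (q - 1) \<le> q * (p div q)"
    using q by (intro mult_left_mono) (auto simp: k_def)
  also have "\<dots> < p"
    using \<open>0 < p mod q\<close> mult_div_mod_eq[of q p] by linarith
  finally show ?thesis
    using that[of q] \<open>1 < q\<close> q below by blast
qed

lemma lift_residue_mod_8:
  assumes "odd f" "f > 0"
  shows "\<exists>c. 0 \<le> c \<and> c < 8 * f \<and> [c = \<beta>] (mod 8) \<and> [c = x] (mod (f :: int))"
proof -
  have "coprime (2 ^ 3) f"
    using assms by (subst coprime_power_left_iff) auto
  then have "coprime 8 f"
    by simp
  then obtain y where y: "[y = \<beta>] (mod 8)" "[y = x] (mod f)"
    using binary_chinese_remainder_int by blast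
  define c where "c = y mod (8 * f)"
  have "[c = y] (mod (8 * f))"
    by (simp add: c_def)
  then have "[c = y] (mod 8)" "[c = y] (mod f)"
    using cong_modulus_mult by (blast, metis cong_modulus_mult mult.commute)
  then show ?thesis
    using y assms cong_trans by (intro exI[of _ c]) (auto simp: c_def)
qed

text \<open>By the Chinese remainder theorem the sign is imposed at a prime of odd exponent, and the
  residue is 1 modulo the remaining factor.\<close>

lemma exists_prescribed_kronecker:
  assumes f: "odd f" "f > 0" "\<not> is_square f" and "\<sigma> \<in> {1, -1}"
  shows "\<exists>c. 0 \<le> c \<and> c < 8 * f \<and> [c = \<beta>] (mod 8) \<and> kronecker c f = \<sigma>"
proof -
  obtain p e g where pg: "prime p" "p > 2" "odd e" "f = p ^ e * g" "\<not> p dvd g" "odd g" "g > 0"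
    using nonsquare_decompose[OF f] by blast
  have "odd p"
    using pg prime_odd_int by blast
  obtain \<nu> where \<nu>: "kronecker \<nu> p = \<sigma>"
  proof (cases "\<sigma> = 1")
    case True
    then show ?thesis using that[of 1] \<open>odd p\<close> pg by simp
  next
    case False
    then show ?thesis using that exists_nonresidue[of p] pg assms(4) by auto
  qed
  have "coprime p g"
    using pg prime_imp_coprime by blast
  then obtain x where x: "[x = \<nu>] (mod p)" "[x = 1] (mod g)"
    using binary_chinese_remainder_int by blast
  have "kronecker x f = kronecker x p * kronecker x g"
    using pg \<open>odd p\<close> by (simp add: kronecker_mult_right kronecker_odd_power_right)
  also have "kronecker x p = \<sigma>"
    using kronecker_cong[OF \<open>odd p\<close> _ x(1)] \<nu> pg by simp
  also have "kronecker x g = 1"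
    using kronecker_cong[OF _ _ x(2)] pg by simp
  finally have "kronecker x f = \<sigma>"
    by simp
  then show ?thesis
    using lift_residue_mod_8[OF f(1,2), of \<beta> x] kronecker_cong[OF f(1,2)] by metis
qed

section \<open>Progressions prime to a square factor\<close>

lemma progression_avoids_prime:
  fixes c M q :: int
  assumes "\<not> (q dvd M \<and> q dvd c)"
  shows "\<exists>t. 0 \<le> t \<and> t \<le> 1 \<and> \<not> q dvd c + M * t"
proof (cases "q dvd c")
  case True
  then show ?thesis
    using assms by (intro exI[of _ 1]) (auto simp: dvd_add_right_iff)
qed (auto intro: exI[of _ 0])

text \<open>Each of the two odd primes divides at most one of the three terms, so at least one term
  survives.\<close>

lemma progression_avoids_two_primes:
  fixes c M q r :: int
  assumes q: "prime q" "q > 2" "\<not> (q dvd M \<and> q dvd c)"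
    and r: "prime r" "r > 2" "\<not> (r dvd M \<and> r dvd c)"
  shows "\<exists>t. 0 \<le> t \<and> t \<le> 2 \<and> \<not> q dvd c + M * t \<and> \<not> r dvd c + M * t"
proof -
  have once: "s = t" if "prime p" "p > 2" "\<not> (p dvd M \<and> p dvd c)"
    "p dvd c + M * s" "p dvd c + M * t" "s \<in> {0,1,2}" "t \<in> {0,1,2}" for p s t
  proof (rule ccontr)
    assume "s \<noteq> t"
    have "p dvd (c + M * s) - (c + M * t)"
      by (rule dvd_diff) (fact that)+
    then have "p dvd M * (s - t)"
      by (simp add: algebra_simps)
    moreover have "\<not> p dvd s - t"
    proof
      assume "p dvd s - t"
      then have "\<bar>p\<bar> \<le> \<bar>s - t\<bar>"
        using \<open>s \<noteq> t\<close> by (intro dvd_imp_le_int) auto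
      moreover have "\<bar>s - t\<bar> \<le> 2"
        using that(6,7) by auto
      ultimately show False
        using that(2) by linarith
    qed
    ultimately have "p dvd M"
      using that(1) prime_dvd_mult_iff by blast
    moreover from this have "p dvd c"
      using that(4) by (simp add: dvd_add_left_iff)
    ultimately show False
      using that(3) by blast
  qed
  have "\<not> (\<forall>t\<in>{0,1,2}. q dvd c + M * t \<or> r dvd c + M * t)"
  proof
    assume *: "\<forall>t\<in>{0,1,2}. q dvd c + M * t \<or> r dvd c + M * t"
    have "\<not> (q dvd c + M * s \<and> q dvd c + M * t)" "\<not> (r dvd c + M * s \<and> r dvd c + M * t)"
      if "s \<noteq> t" "s \<in> {0,1,2}" "t \<in> {0,1,2}" for s t
      using once[OF q, of s t] once[OF r, of s t] that by blast+
    from this[of 0 1] this[of 0 2] this[of 1 2] * show False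
      by auto
  qed
  then obtain t where "t \<in> {0,1,2}" "\<not> (q dvd c + M * t \<or> r dvd c + M * t)"
    by blast
  then show ?thesis
    by (intro exI[of _ t]) auto
qed

lemma odd_of_cong_mod_8:
  fixes b n :: int
  assumes "odd n" "[b = 3 * (n - 2)] (mod 8)"
  shows "odd b"
  using assms cong_dvd_iff[OF cong_dvd_modulus[OF assms(2), of 2]] by simp

text \<open>Once \<open>b\<close> is coprime to \<open>s\<close>, \<open>(b/n) = (b/f)\<close>, and
  this is unaffected by steps of \<open>8 * f\<close>. At most \<open>T\<close> steps from
  \<open>c < 8 * f\<close> give \<open>3 * b < 24 * f * (T + 1) \<le> n\<close>.\<close>

lemma orbit_numerator_square_factor:
  assumes n: "n = f * s\<^sup>2" and f: "odd f" "f > 0" "\<not> is_square f" and s: "odd s" "s > 0"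
    and T: "T \<ge> 0" "24 * (T + 1) \<le> s\<^sup>2"
    and cop: "\<And>c. coprime c f \<Longrightarrow> \<exists>t. 0 \<le> t \<and> t \<le> T \<and> coprime (c + 8 * f * t) s"
  shows "orbit_numerator n"
proof -
  have "\<exists>b. 0 < b \<and> 3 * b + 2 \<le> n \<and> [b = 3 * (n - 2)] (mod 8) \<and> kronecker b n = \<sigma>"
    if "\<sigma> \<in> {1, -1}" for \<sigma>
  proof -
    obtain c where c: "0 \<le> c" "c < 8 * f" "[c = 3 * (n - 2)] (mod 8)" "kronecker c f = \<sigma>"
      using exists_prescribed_kronecker[OF f \<open>\<sigma> \<in> {1, -1}\<close>] by blast
    then have "coprime c f"
      using kronecker_eq_0_iff[OF f(1,2), of c] that by auto
    then obtain t where t: "0 \<le> t" "t \<le> T" "coprime (c + 8 * f * t) s"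
      using cop by blast
    define b where "b = c + 8 * f * t"
    have cong: "[b = 3 * (n - 2)] (mod 8)"
      using c(3) by (simp add: b_def cong_def mult.assoc)
    have "odd n"
      using n f s by simp
    have "odd b"
      using odd_of_cong_mod_8 \<open>odd n\<close> cong by blast
    have "b \<ge> 0"
      using c t f by (simp add: b_def)
    then have "b > 0"
      using \<open>odd b\<close> by (cases "b = 0") auto
    have "8 * f * t \<le> 8 * f * T"
      using f t by simp
    then have "b < 8 * f * (T + 1)"
      using c(2) unfolding b_def by (simp add: algebra_simps)
    then have "3 * b + 2 \<le> f * (24 * (T + 1))"
      by (simp add: algebra_simps)
    also have "\<dots> \<le> n"
      unfolding n using f T by (intro mult_left_mono) auto
    finally have "3 * b + 2 \<le> n" .
    have "kronecker b n = kronecker b f * (kronecker b s)\<^sup>2"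
      using f s by (simp add: n kronecker_mult_right power2_eq_square)
    also have "kronecker b f = \<sigma>"
      using kronecker_cong[OF f(1,2), of b c] c(4) by (simp add: b_def cong_iff_dvd_diff)
    also have "(kronecker b s)\<^sup>2 = 1"
      using kronecker_values[OF s, of b] kronecker_eq_0_iff[OF s, of b] t(3) by (auto simp: b_def)
    finally show ?thesis
      using \<open>b > 0\<close> \<open>3 * b + 2 \<le> n\<close> cong by (intro exI[of _ b]) simp
  qed
  from this[of 1] this[of "-1"] obtain b c where
    "0 < b" "3 * b + 2 \<le> n" "[b = 3 * (n - 2)] (mod 8)" "kronecker b n = 1"
    "0 < c" "3 * c + 2 \<le> n" "[c = 3 * (n - 2)] (mod 8)" "kronecker c n = -1"
    by auto
  then show ?thesis
    using orbit_numerator_opposite_signs[of n b c] n f s by simp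
qed

lemma is_square_times_square:
  assumes "is_square f"
  shows "is_square (f * s\<^sup>2 :: int)"
  using assms by (intro is_nth_power_mult) auto

text \<open>One step suffices to avoid a single prime, and \<open>24 * 2 \<le> 49\<close> explains
  the bound 7.\<close>

lemma orbit_numerator_prime_square_dvd:
  assumes n: "odd n" "n > 0" "\<not> is_square n" and q: "prime q" "q \<ge> 7" "q\<^sup>2 dvd n"
  shows "orbit_numerator n"
proof -
  obtain f where f: "n = f * q\<^sup>2"
    using q(3) by (metis dvd_div_mult_self)
  have "odd q" "odd f"
    using n(1) f q by auto
  have "f > 0"
    using n(2) f by (simp add: zero_less_mult_iff)
  have "(49::int) \<le> q\<^sup>2"
    using power_mono[of 7 q 2] q by simp
  show ?thesis
  proof (rule orbit_numerator_square_factor[OF f, of 1])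
    show "\<not> is_square f"
      using n(3) f is_square_times_square by blast
    fix c assume "coprime c f"
    have "\<not> q dvd 8"
    proof
      assume "q dvd 8"
      then have "q dvd 2 ^ 3"
        by simp
      then have "q dvd 2"
        using q(1) prime_dvd_power by blast
      then show False
        using q(2) by (auto dest: zdvd_imp_le)
    qed
    then have "\<not> (q dvd 8 * f \<and> q dvd c)"
      using \<open>coprime c f\<close> q(1) by (meson coprime_common_divisor not_prime_unit prime_dvd_mult_iff)
    from progression_avoids_prime[OF this]
    show "\<exists>t\<ge>0. t \<le> 1 \<and> coprime (c + 8 * f * t) q"
      using q(1) by (metis coprime_commute prime_imp_coprime)
  qed (use \<open>odd q\<close> \<open>odd f\<close> \<open>f > 0\<close> q \<open>49 \<le> q\<^sup>2\<close> in auto)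
qed

text \<open>The squares 9 and 25 are too small for the previous argument, so products of two of
  these primes are used. Two steps avoid both 3 and 5, and \<open>24 * 3 \<le> 81\<close>.\<close>

lemma orbit_numerator_3_5_powers:
  assumes n: "odd n" "n > 0" "\<not> is_square n" and dvd: "81 dvd n \<or> 225 dvd n \<or> 625 dvd n"
  shows "orbit_numerator n"
proof -
  have "\<exists>s\<in>{9, 15, 25}. s\<^sup>2 dvd n"
    using dvd by auto
  then obtain s f where s: "s \<in> {9, 15, 25}" and f: "n = f * s\<^sup>2"
    by (metis dvd_div_mult_self)
  have "odd s" "odd f"
    using n(1) f by auto
  have "f > 0"
    using n(2) f by (simp add: zero_less_mult_iff)
  show ?thesis
  proof (rule orbit_numerator_square_factor[OF f, of 2])
    show "\<not> is_square f"
      using n(3) f is_square_times_square by blast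
    fix c assume "coprime c f"
    have "\<not> (q dvd 8 * f \<and> q dvd c)" if "q \<in> {3, 5}" for q
    proof -
      have "prime q" "\<not> q dvd 8"
        using that by auto
      then show ?thesis
        using \<open>coprime c f\<close> by (meson coprime_common_divisor not_prime_unit prime_dvd_mult_iff)
    qed
    from progression_avoids_two_primes[OF _ _ this _ _ this, of 3 5]
    obtain t where t: "0 \<le> t" "t \<le> 2" "\<not> 3 dvd c + 8 * f * t" "\<not> 5 dvd c + 8 * f * t"
      by auto
    then have "coprime (c + 8 * f * t) 3" "coprime (c + 8 * f * t) 5"
      by (auto simp: coprime_commute intro!: prime_imp_coprime)
    then have "coprime (c + 8 * f * t) (3 * 3)" "coprime (c + 8 * f * t) (3 * 5)"
        "coprime (c + 8 * f * t) (5 * 5)"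
      by (simp_all only: coprime_mult_right_iff simp_thms)
    then have "coprime (c + 8 * f * t) s"
      using s by auto
    then show "\<exists>t\<ge>0. t \<le> 2 \<and> coprime (c + 8 * f * t) s"
      using t by blast
  qed (use \<open>odd s\<close> \<open>odd f\<close> \<open>f > 0\<close> s in auto)
qed

subsection \<open>Splitting off a factor\<close>

lemma exists_inverse_mod:
  fixes u m :: int
  assumes "coprime u m"
  obtains v where "[u * v = 1] (mod m)"
  using cong_solve_coprime_int[OF assms] by blast

text \<open>Scaling by a unit \<open>u\<close> multiplies the product by \<open>(u/h)\<close>
  squared, so neighbours \<open>z\<close>, \<open>z + 1\<close> provide pairs at any distance
  coprime to \<open>h\<close>.\<close>

lemma kronecker_step_scale:
  fixes u :: int
  assumes h: "odd h" "h > 0" and "coprime u h" "kronecker z h * kronecker (z + 1) h = \<sigma>"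
  shows "kronecker (u * z) h * kronecker (u * z + u) h = \<sigma>"
proof -
  have "kronecker (u * z + u) h = kronecker u h * kronecker (z + 1) h"
    using kronecker_mult_left[OF h, of u "z + 1"] by (simp add: algebra_simps)
  moreover have "kronecker u h * kronecker u h = 1"
    using kronecker_values[OF h, of u] kronecker_eq_0_iff[OF h, of u] assms(3) by auto
  ultimately show ?thesis
    using assms(4) by (simp add: kronecker_mult_left[OF h] algebra_simps)
qed

text \<open>The least nonresidue and its predecessor have opposite symbols; scale this pair by
  \<open>u\<close>.\<close>

lemma kronecker_flip_prime_power:
  fixes p :: int
  assumes p: "prime p" "p > 2" and "odd e" "coprime u p"
  shows "\<exists>y. kronecker y (p ^ e) * kronecker (y + u) (p ^ e) = -1"
proof -
  have odd: "odd p"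
    using p prime_odd_int by blast
  obtain q where q: "1 < q" "kronecker q p = -1" "\<And>x. 0 < x \<Longrightarrow> x < q \<Longrightarrow> kronecker x p = 1"
    using least_nonresidue[OF p] by blast
  have "kronecker (q - 1) p * kronecker (q - 1 + 1) p = -1"
    using q by simp
  then have "kronecker (u * (q - 1)) p * kronecker (u * (q - 1) + u) p = -1"
    using odd p assms(4) by (intro kronecker_step_scale) auto
  then show ?thesis
    using odd p \<open>odd e\<close> by (auto simp: kronecker_odd_power_right)
qed

text \<open>If \<open>3 y = u\<close> modulo \<open>h\<close>, then \<open>y + u = 4 y\<close>.\<close>

lemma kronecker_no_flip:
  fixes h u :: int
  assumes h: "odd h" "h > 0" "\<not> 3 dvd h" and "coprime u h"
  shows "\<exists>y. kronecker y h * kronecker (y + u) h = 1"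
proof -
  have "coprime 3 h"
    using h(3) by (intro prime_imp_coprime) auto
  then obtain v where v: "[3 * v = 1] (mod h)"
    by (rule exists_inverse_mod)
  have "coprime v h"
    using v by (metis coprime_iff_invertible_int mult.commute)
  then have nz: "kronecker v h \<noteq> 0"
    using kronecker_eq_0_iff[OF h(1,2)] by simp
  have "[v + 1 = v + 3 * v] (mod h)"
    using v by (intro cong_add cong_refl) (rule cong_sym)
  then have "kronecker (v + 1) h = kronecker (2\<^sup>2 * v) h"
    using kronecker_cong[OF h(1,2)] by simp
  also have "\<dots> = kronecker v h"
    using kronecker_mult_left[OF h(1,2), of "2\<^sup>2" v] kronecker_square_left[OF h(1,2), of 2] h(1)
    by simp
  finally have "kronecker v h * kronecker (v + 1) h = 1"
    using nz kronecker_values[OF h(1,2), of v] by auto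
  from kronecker_step_scale[OF h(1,2) assms(4) this] show ?thesis
    by blast
qed

lemma kronecker_flip_combine:
  fixes h k u :: int
  assumes "odd h" "h > 0" "odd k" "k > 0" "coprime h k"
    and "\<exists>y. kronecker y h * kronecker (y + u) h = \<sigma>" "\<exists>y. kronecker y k * kronecker (y + u) k = \<tau>"
  shows "\<exists>y. kronecker y (h * k) * kronecker (y + u) (h * k) = \<sigma> * \<tau>"
proof -
  obtain y z where yz: "kronecker y h * kronecker (y + u) h = \<sigma>"
    "kronecker z k * kronecker (z + u) k = \<tau>"
    using assms by blast
  obtain x where x: "[x = y] (mod h)" "[x = z] (mod k)"
    using binary_chinese_remainder_int[OF assms(5)] by blast
  have "kronecker x h = kronecker y h" "kronecker (x + u) h = kronecker (y + u) h"
    "kronecker x k = kronecker z k" "kronecker (x + u) k = kronecker (z + u) k"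
    using x assms by (auto intro!: kronecker_cong cong_add)
  then show ?thesis
    using yz assms by (intro exI[of _ x]) (simp add: kronecker_mult_right mult_ac)
qed

text \<open>The sign change is placed at one prime of odd exponent and avoided elsewhere.
  \<open>kronecker_no_flip\<close> excludes the prime 3, so its power is split off: an odd power of
  3 carries the change itself, while for an even power the pair \<open>u\<close>,
  \<open>2 * u\<close> gives product 1.\<close>

lemma kronecker_flip:
  fixes h u :: int
  assumes h: "odd h" "h > 0" "\<not> is_square h" and u: "coprime u h"
  shows "\<exists>y. kronecker y h * kronecker (y + u) h = -1"
proof -
  obtain i g where g: "h = 3 ^ i * g" "\<not> 3 dvd g"
    by (rule multiplicity_decompose'[of h 3]) (use h(2) in auto)
  have "odd g"
    using g h by auto
  have "g > 0"
    using g(1) h(2) by (simp add: zero_less_mult_iff)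
  have cop: "coprime (3 ^ i) g"
    using g(2) by (cases "i = 0") (auto simp: coprime_power_left_iff intro!: prime_imp_coprime)
  have u3: "coprime u 3" if "i > 0"
    using u that unfolding g by (cases i) auto
  have ug: "coprime u g"
    using u unfolding g by simp
  show ?thesis
  proof (cases "odd i")
    case True
    then have "\<exists>y. kronecker y (3 ^ i) * kronecker (y + u) (3 ^ i) = -1"
      using u3 by (intro kronecker_flip_prime_power) (auto simp: odd_pos)
    moreover have "\<exists>y. kronecker y g * kronecker (y + u) g = 1"
      using \<open>odd g\<close> \<open>g > 0\<close> g(2) ug by (rule kronecker_no_flip)
    ultimately show ?thesis
      using kronecker_flip_combine[of "3 ^ i" g u "-1" 1] \<open>odd g\<close> \<open>g > 0\<close> cop g by auto
  next
    case False
    then obtain j where j: "i = 2 * j"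
      by (auto elim: evenE)
    have "\<not> is_square g"
      using h(3) is_square_times_square[of g "3 ^ j"] g j by (auto simp: power_mult mult.commute)
    then obtain p e f where f: "prime p" "p > 2" "odd e" "g = p ^ e * f" "\<not> p dvd f" "odd f" "f > 0"
      using nonsquare_decompose[OF \<open>odd g\<close> \<open>g > 0\<close>] by blast
    have "odd p"
      using f prime_odd_int by blast
    have "\<not> 3 dvd f"
      using f g(2) by auto
    have "coprime u p" "coprime u f"
      using ug f(3) unfolding f(4) by (auto simp: coprime_power_right_iff odd_pos)
    have "\<exists>y. kronecker y (p ^ e) * kronecker (y + u) (p ^ e) = -1"
      using f \<open>coprime u p\<close> by (intro kronecker_flip_prime_power)
    moreover have "\<exists>y. kronecker y f * kronecker (y + u) f = 1"
      using f \<open>\<not> 3 dvd f\<close> \<open>coprime u f\<close> by (intro kronecker_no_flip)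
    ultimately have "\<exists>y. kronecker y (p ^ e * f) * kronecker (y + u) (p ^ e * f) = -1 * 1"
      using f \<open>odd p\<close> by (intro kronecker_flip_combine)
        (auto intro!: prime_imp_coprime simp: coprime_power_left_iff)
    moreover have "\<exists>y. kronecker y (3 ^ i) * kronecker (y + u) (3 ^ i) = 1"
    proof (cases "j = 0")
      case False
      then have "kronecker u 3 \<in> {1, -1}"
        using u3 j kronecker_values[of 3 u] kronecker_eq_0_iff[of 3 u] by auto
      moreover have "kronecker (u + u) 3 = kronecker 2 3 * kronecker u 3"
        by (simp flip: kronecker_mult_left)
      then have "kronecker (u + u) 3 = - kronecker u 3"
        by (simp add: kronecker_two)
      ultimately have "kronecker u 3 * kronecker (u + u) 3 = -1"
        by auto
      then have "kronecker u (3 ^ i) * kronecker (u + u) (3 ^ i) = (-1) ^ i"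
        by (simp only: kronecker_power_right zero_less_numeral flip: power_mult_distrib)
      then have "kronecker u (3 ^ i) * kronecker (u + u) (3 ^ i) = 1"
        using j by simp
      then show ?thesis
        by blast
    qed (simp add: j)
    ultimately show ?thesis
      using kronecker_flip_combine[of "3 ^ i" g u 1 "-1"] \<open>odd g\<close> \<open>g > 0\<close> cop g f(4) by auto
  qed
qed

text \<open>The numbers \<open>b\<close> and \<open>b + 8 * G\<close> agree modulo 8 and modulo
  \<open>G\<close>, so their symbols can differ only through \<open>h\<close>, where
  \<open>kronecker_flip\<close> at distance \<open>8 * G\<close> applies. Moving \<open>b\<close> by
  \<open>t\<close> steps of \<open>8 * h\<close> makes the symbol modulo \<open>G\<close> nonzero;
  the size condition keeps \<open>b + 8 * G\<close> in range.\<close>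

lemma orbit_numerator_coprime_factors:
  assumes n: "n = h * G" and h: "odd h" "h > 0" "\<not> is_square h" and G: "odd G" "G > 0"
    and hG: "coprime h G" and T: "T \<ge> 0" "24 * h * (T + 1) + 24 * G + 2 \<le> h * G"
    and cop: "\<And>c. \<exists>t. 0 \<le> t \<and> t \<le> T \<and> coprime (c + 8 * h * t) G"
  shows "orbit_numerator n"
proof -
  have "coprime (2 ^ 3) h"
    using h(1) by (subst coprime_power_left_iff) auto
  then have "coprime (8 * G) h"
    using hG by (simp add: coprime_commute)
  then obtain y where y: "kronecker y h * kronecker (y + 8 * G) h = -1"
    using kronecker_flip[OF h] by blast
  obtain c where c: "0 \<le> c" "c < 8 * h" "[c = 3 * (n - 2)] (mod 8)" "[c = y] (mod h)"
    using lift_residue_mod_8[OF h(1,2)] by blast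
  obtain t where t: "0 \<le> t" "t \<le> T" "coprime (c + 8 * h * t) G"
    using cop by blast
  define b where "b = c + 8 * h * t"
  have "odd n"
    using n h G by simp
  have cong: "[b = 3 * (n - 2)] (mod 8)" "[b + 8 * G = 3 * (n - 2)] (mod 8)"
    using c(3) by (simp_all add: b_def cong_def mult.assoc)
  have "odd b"
    using odd_of_cong_mod_8 \<open>odd n\<close> cong by blast
  have "b \<ge> 0"
    using c t h by (simp add: b_def)
  then have "b > 0"
    using \<open>odd b\<close> by (cases "b = 0") auto
  have "h * t \<le> h * T"
    using h t by simp
  then have "b < 8 * h * (T + 1)"
    using c(2) unfolding b_def by (simp add: algebra_simps)
  then have bound: "3 * (b + 8 * G) + 2 \<le> n"
    using T(2) n by (simp add: algebra_simps)
  have bh: "[b = y] (mod h)"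
    using c(4) by (simp add: b_def cong_def mult.assoc mult.left_commute[of _ h])
  then have "kronecker b h = kronecker y h" "kronecker (b + 8 * G) h = kronecker (y + 8 * G) h"
    using h by (auto intro!: kronecker_cong cong_add)
  moreover have "kronecker (b + 8 * G) G = kronecker b G"
    using G by (intro kronecker_cong) (auto simp: cong_iff_dvd_diff)
  moreover have "kronecker b G * kronecker b G = 1"
    using kronecker_values[OF G, of b] kronecker_eq_0_iff[OF G, of b] t(3) by (auto simp: b_def)
  ultimately have "kronecker b n * kronecker (b + 8 * G) n = -1"
    using y h G by (simp add: n kronecker_mult_right algebra_simps)
  then show ?thesis
    using orbit_numerator_opposite_signs[OF \<open>odd n\<close>, of b "b + 8 * G"] \<open>b > 0\<close> bound cong G by simp
qed

text \<open>
  Let \<open>r\<close> be a nonresidue. Multiplication by \<open>r\<close> turns an interval of length \<open>K\<close> into a progression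
  of length \<open>r K \<ge> p\<close> with gaps at most \<open>K\<close>, which therefore meets the interval again.
\<close>

lemma kronecker_not_constant_on_run:
  fixes p K z :: int
  assumes p: "prime p" "p > 2" and K: "K \<ge> 104" "p \<le> 26 * K"
  shows "\<exists>k l. 0 \<le> k \<and> k \<le> K \<and> 0 \<le> l \<and> l \<le> K \<and> kronecker (z + k) p * kronecker (z + l) p = -1"
proof -
  have odd: "odd p"
    using p prime_odd_int by blast
  have p0: "p > 0"
    using p by simp
  note mult_left = kronecker_mult_left[OF odd p0]
  note cong_kron = kronecker_cong[OF odd p0]
  obtain q where q: "1 < q" "kronecker q p = -1" "q * (q - 1) < p"
    using least_nonresidue[OF p] by blast
  \<comment> \<open>If \<open>q > 52\<close>, then
    \<open>52 * q \<le> q * (q - 1) < p \<le> 26 * K\<close>; otherwise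
    \<open>2 * q \<le> 104\<close>.\<close>
  have "2 * q \<le> K"
  proof (cases "q \<le> 52")
    case False
    then have "q * 52 \<le> q * (q - 1)"
      using q by (intro mult_left_mono) auto
    then show ?thesis
      using q K by linarith
  qed (use K in auto)
  have sq: "kronecker (m\<^sup>2 * q) p = -1" if "m \<in> {2, 4}" for m
  proof -
    have "coprime m p"
      using odd that by (auto simp: coprime_left_2_iff_odd) (metis coprime_left_2_iff_odd
          coprime_mult_left_iff mult_2 numeral_Bit0)
    then show ?thesis
      using q kronecker_square_left[OF odd p0, of m] by (simp add: mult_left)
  qed
  \<comment> \<open>Multiplying \<open>q\<close> by 1, 4 or 16 keeps it a nonresidue and brings it
    into the range from 26 to \<open>K\<close>; there \<open>r * K\<close> reaches
    \<open>p\<close>.\<close>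
  obtain r where r: "26 \<le> r" "r \<le> K" "kronecker r p = -1"
  proof -
    consider "26 \<le> q" | "7 \<le> q" "q < 26" | "q < 7"
      by linarith
    then show ?thesis
    proof cases
      case 1
      then show ?thesis using that[of q] q \<open>2 * q \<le> K\<close> by simp
    next
      case 2
      then show ?thesis using that[of "4 * q"] sq[of 2] K by simp
    next
      case 3
      then show ?thesis using that[of "16 * q"] sq[of 4] K q by simp
    qed
  qed
  define w where "w = ((r - 1) * z) mod p"
  have w: "0 \<le> w" "w < p"
    using p0 by (simp_all add: w_def)
  have w_cong: "[(r - 1) * z = w] (mod p)"
    by (simp add: w_def)
  \<comment> \<open>The congruence means that \<open>l\<close> is \<open>w + r * k\<close> modulo
    \<open>p\<close>. If \<open>w \<le> K\<close>, take \<open>k = 0\<close>; otherwise take the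
    first \<open>k\<close> at which \<open>w + r * k\<close> reaches \<open>p\<close>, which
    overshoots by less than \<open>r\<close>.\<close>
  obtain k l where kl: "0 \<le> k" "k \<le> K" "0 \<le> l" "l \<le> K" "[r * (z + k) = z + l] (mod p)"
  proof (cases "w \<le> K")
    case True
    have "[r * (z + 0) = z + w] (mod p)"
      using cong_add[OF cong_refl[of z] w_cong] by (simp add: algebra_simps)
    then show ?thesis
      using that[of 0 w] w True K by simp
  next
    case False
    define k where "k = (p - w + r - 1) div r"
    define l where "l = w + r * k - p"
    define s where "s = (p - w + r - 1) mod r"
    have eq: "r * k = p - w + r - 1 - s"
      unfolding k_def s_def by (simp add: minus_mod_eq_mult_div)
    have s: "0 \<le> s" "s < r"
      using r by (simp_all add: s_def)
    have "r * k < 26 * K"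
      using eq s False r K by linarith
    also have "\<dots> \<le> r * K"
      using r K by (intro mult_right_mono) auto
    finally have "k \<le> K"
      using r by simp
    moreover have "0 \<le> k"
      using w r by (auto simp: k_def intro!: pos_imp_zdiv_nonneg_iff[THEN iffD2])
    moreover have "0 \<le> l" "l \<le> K"
      using eq s r by (auto simp: l_def)
    moreover have "[r * (z + k) = z + l] (mod p)"
    proof -
      have "[z + ((r - 1) * z + r * k) = z + (w + r * k)] (mod p)"
        by (intro cong_add cong_refl w_cong)
      also have "[z + (w + r * k) = z + l] (mod p)"
        by (simp add: l_def cong_iff_dvd_diff)
      finally show ?thesis
        by (simp add: algebra_simps)
    qed
    ultimately show ?thesis
      using that by blast
  qed
  show ?thesis
  proof (cases "p dvd z + k")
    case False
    then have "coprime (z + k) p"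
      using p(1) by (metis coprime_commute prime_imp_coprime)
    then have "kronecker (z + k) p * kronecker (z + k) p = 1"
      using kronecker_values[OF odd p0, of "z + k"] kronecker_eq_0_iff[OF odd p0, of "z + k"] by auto
    moreover have "kronecker (z + l) p = - kronecker (z + k) p"
      using cong_kron[OF kl(5)] r by (simp add: mult_left)
    ultimately show ?thesis
      using kl by (intro exI[of _ k] exI[of _ l]) auto
  next
    case True
    \<comment> \<open>Here the symbol at \<open>z + k\<close> is 0. The neighbours at offsets 1 and
      \<open>q\<close>, or -1 and \<open>-q\<close>, have opposite symbols, and
      \<open>2 * q \<le> K\<close> leaves room for them on one side.\<close>
    have shift: "kronecker (z + (k + x)) p = kronecker x p" for x
      using True by (intro cong_kron) (simp add: cong_iff_dvd_diff add.assoc[symmetric])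
    show ?thesis
    proof (cases "2 * k \<le> K")
      case True
      then show ?thesis
        using shift[of 1] shift[of q] kl \<open>2 * q \<le> K\<close> q K odd p0
        by (intro exI[of _ "k + 1"] exI[of _ "k + q"]) auto
    next
      case False
      have "kronecker (-1) p * kronecker (-1) p = 1"
        using kronecker_minus_one[OF odd p0] by simp
      moreover have "kronecker (- q) p = - kronecker (-1) p"
        using mult_left[of "-1" q] q by simp
      ultimately show ?thesis
        using shift[of "-1"] shift[of "-q"] kl \<open>2 * q \<le> K\<close> q K False
        by (intro exI[of _ "k + -1"] exI[of _ "k + -q"]) auto
    qed
  qed
qed

text \<open>Let \<open>b\<close> run through \<open>c + 8 * g * k\<close> with \<open>c\<close>
  equal to 1 modulo \<open>g\<close>, so that \<open>(b/n) = (b/p)\<close>. Dividing by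
  \<open>8 * g\<close> modulo \<open>p\<close> turns this progression into a run of consecutive
  integers, on which the symbol is not constant.\<close>

lemma orbit_numerator_large_prime_factor:
  assumes n: "n = p * g" and p: "prime p" "p \<ge> 2600" "\<not> p dvd g" and g: "odd g" "g > 0"
  shows "orbit_numerator n"
proof -
  \<comment> \<open>The largest \<open>K\<close> with \<open>24 * (K + 1) + 2 \<le> p\<close>;
    \<open>p \<ge> 2600\<close> makes it at least 104.\<close>
  define K where "K = (p - 2) div 24 - 1"
  define m where "m = (p - 2) mod 24"
  have m: "p = 24 * (K + 1) + m + 2" "0 \<le> m" "m < 24"
    by (simp_all add: K_def m_def)
  have K1: "K \<ge> 104" and K3: "24 * (K + 1) + 2 \<le> p"
    using m p(2) by simp_all
  then have K2: "p \<le> 26 * K"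
    using m by simp
  note K = K1 K2 K3
  have "odd p"
    using p prime_odd_int by force
  then have "odd n"
    using n g by simp
  obtain c where c: "0 \<le> c" "c < 8 * g" "[c = 3 * (n - 2)] (mod 8)" "[c = 1] (mod g)"
    using lift_residue_mod_8[OF g] by blast
  have "coprime (2 ^ 3) p"
    using \<open>odd p\<close> by (subst coprime_power_left_iff) auto
  moreover have "coprime g p"
    using p by (metis coprime_commute prime_imp_coprime)
  ultimately have "coprime (8 * g) p"
    by simp
  then obtain v where v: "[8 * g * v = 1] (mod p)"
    by (rule exists_inverse_mod)
  define b where "b = (\<lambda>k. c + 8 * g * k)"
  have cong: "[b k = 3 * (n - 2)] (mod 8)" for k
    using c(3) by (simp add: b_def cong_def mult.assoc)
  have bounds: "b k > 0" "3 * b k + 2 \<le> n" if "0 \<le> k" "k \<le> K" for k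
  proof -
    have "odd (b k)"
      using odd_of_cong_mod_8 \<open>odd n\<close> cong by blast
    moreover have "b k \<ge> 0"
      using c g that by (simp add: b_def)
    ultimately show "b k > 0"
      by (cases "b k = 0") auto
    have "g * k \<le> g * K"
      using g that by simp
    then have "b k < 8 * g * (K + 1)"
      using c(2) by (simp add: b_def algebra_simps)
    then have "3 * b k + 2 \<le> g * (24 * (K + 1))"
      by (simp add: algebra_simps)
    also have "\<dots> \<le> g * p"
      using g K by (intro mult_left_mono) auto
    finally show "3 * b k + 2 \<le> n"
      by (simp add: n mult.commute)
  qed
  have kron: "kronecker (b k) n = kronecker (8 * g) p * kronecker (c * v + k) p" for k
  proof -
    have "[b k = 1 + 0] (mod g)"
      unfolding b_def by (intro cong_add c(4)) (simp add: cong_0_iff)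
    then have "kronecker (b k) g = 1"
      using kronecker_cong[OF g, of "b k" 1] g by simp
    moreover have "[c * 1 + 8 * g * k = c * (8 * g * v) + 8 * g * k] (mod p)"
      by (intro cong_add cong_mult cong_refl cong_sym[OF v])
    then have "kronecker (b k) p = kronecker (8 * g * (c * v + k)) p"
      using \<open>odd p\<close> p by (intro kronecker_cong) (auto simp: b_def algebra_simps)
    ultimately show ?thesis
      using \<open>odd p\<close> p g by (simp add: n kronecker_mult_right kronecker_mult_left)
  qed
  obtain k l where kl: "0 \<le> k" "k \<le> K" "0 \<le> l" "l \<le> K"
    "kronecker (c * v + k) p * kronecker (c * v + l) p = -1"
    using kronecker_not_constant_on_run[of p K "c * v"] p K by auto
  moreover have "kronecker (8 * g) p * kronecker (8 * g) p = 1"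
    using kronecker_values[of p "8 * g"] kronecker_eq_0_iff[of p "8 * g"] \<open>odd p\<close> p
      \<open>coprime (8 * g) p\<close> by auto
  ultimately have "kronecker (b k) n * kronecker (b l) n = -1"
    unfolding kron by (simp add: algebra_simps)
  then show ?thesis
    using orbit_numerator_opposite_signs[OF \<open>odd n\<close>, of "b k" "b l"] bounds[of k] bounds[of l] cong kl
    by blast
qed

subsection \<open>Large odd numbers\<close>

lemma odd_prime_divisor:
  fixes m :: int
  assumes "odd m" "m > 1"
  obtains p where "prime p" "p dvd m" "p = 3 \<or> p = 5 \<or> p \<ge> 7"
proof -
  have "\<not> is_unit m"
    using assms by auto
  then obtain p where p: "prime p" "p dvd m"
    using prime_divisor_exists[of m] assms by auto
  have "odd p"
    using p assms dvd_trans by blast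
  moreover have "p \<ge> 2"
    using p prime_ge_2_int by blast
  ultimately have "p = 3 \<or> p = 5 \<or> p \<ge> 7"
    by presburger
  then show ?thesis
    using that p by blast
qed

lemma prime_ge_7_cases:
  fixes p :: int
  assumes "prime p" "p \<ge> 7" "p \<noteq> 7"
  shows "p \<ge> 11"
proof (rule ccontr)
  assume "\<not> p \<ge> 11"
  then have "p \<in> {8, 9, 10}"
    using assms by auto
  then show False
    using assms(1) by auto
qed

text \<open>An odd \<open>m \<ge> 7\<close> has a prime factor at least 7 or is divisible by 9, 15
  or 25.\<close>

lemma orbit_numerator_large_square_dvd:
  assumes n: "odd n" "n > 0" "\<not> is_square n" and m: "m\<^sup>2 dvd n" "m \<ge> 7"
  shows "orbit_numerator n"
proof -
  have "odd m"
    using m(1) n(1) by (meson dvd_trans even_power zero_less_numeral)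
  then obtain p where p: "prime p" "p dvd m" "p = 3 \<or> p = 5 \<or> p \<ge> 7"
    using odd_prime_divisor m(2) by (metis one_less_numeral_iff order_less_le_trans semiring_norm(77))
  show ?thesis
  proof (cases "p \<ge> 7")
    case True
    then show ?thesis
      using orbit_numerator_prime_square_dvd n p m(1) by (meson dvd_power_same dvd_trans)
  next
    case False
    obtain k where k: "m = p * k"
      using p(2) by (elim dvdE)
    have "odd k" "k > 1"
      using \<open>odd m\<close> m(2) k p(3) False by auto
    then obtain q where q: "prime q" "q dvd k" "q = 3 \<or> q = 5 \<or> q \<ge> 7"
      using odd_prime_divisor by metis
    have pq: "(p * q)\<^sup>2 dvd n"
      using k q(2) m(1) by (meson dvd_power_same dvd_trans dvd_refl mult_dvd_mono)
    show ?thesis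
    proof (cases "q \<ge> 7")
      case True
      then show ?thesis
        using orbit_numerator_prime_square_dvd n q pq by (meson dvd_power_same dvd_trans dvd_triv_right)
    next
      case False
      then have "81 dvd n \<or> 225 dvd n \<or> 625 dvd n"
        using pq p(3) q(3) \<open>\<not> p \<ge> 7\<close> by auto
      then show ?thesis
        using orbit_numerator_3_5_powers n by blast
    qed
  qed
qed

text \<open>Take \<open>G = q\<close> and \<open>T = 1\<close>, unless the cofactor \<open>h\<close>
  is a square; in that case \<open>h > 25\<close> is the square of an odd number at least 7.\<close>

lemma orbit_numerator_prime_factor_ge_53:
  assumes n: "odd n" "n \<ge> 65000" "\<not> is_square n" and q: "prime q" "q \<ge> 53" "q dvd n"
  shows "orbit_numerator n"
proof (rule ccontr)
  assume neg: "\<not> orbit_numerator n"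
  obtain h where h: "n = h * q"
    using q(3) by (metis dvdE mult.commute)
  have "odd h" "odd q"
    using n h by auto
  have "h > 0"
    using n(2) h q zero_less_mult_pos2[of h q] by simp
  have "\<not> q dvd h"
  proof
    assume "q dvd h"
    then have "q\<^sup>2 dvd n"
      unfolding h power2_eq_square by simp
    then show False
      using neg orbit_numerator_prime_square_dvd[of n q] n q by auto
  qed
  have "q < 2600"
    using neg orbit_numerator_large_prime_factor[of n q h] h q \<open>\<not> q dvd h\<close> \<open>odd h\<close> \<open>h > 0\<close>
    by (force simp: mult.commute)
  \<comment> \<open>The threshold is \<open>65000 = 25 * 2600\<close>.\<close>
  have "h > 25"
  proof (rule ccontr)
    assume "\<not> h > 25"
    then have "h * q \<le> 25 * q"
      using q by (intro mult_right_mono) auto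
    then show False
      using n h \<open>q < 2600\<close> by simp
  qed
  show False
  proof (cases "is_square h")
    case True
    then obtain m0 where "h = m0\<^sup>2"
      by (elim is_nth_powerE)
    then obtain m where m: "h = m\<^sup>2" "m \<ge> 0"
      using power2_abs[of m0] by (metis abs_ge_zero)
    have "m > 5"
      using \<open>h > 25\<close> m power_less_imp_less_base[of 5 2 m] by simp
    moreover have "odd m"
      using m \<open>odd h\<close> by auto
    ultimately have "m \<ge> 7"
      by presburger
    then show False
      using neg orbit_numerator_large_square_dvd[of n m] n h m by simp
  next
    case False
    have bound: "24 * h * (1 + 1) + 24 * q + 2 \<le> h * q"
    proof (rule ccontr)
      assume neg': "\<not> ?thesis"
      \<comment> \<open>The required bound is \<open>P \<ge> 24 * 48 + 2\<close>. Both factors are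
        positive, so failure bounds \<open>h\<close> and \<open>q\<close>, and then
        \<open>h * q < 48 * h + 24 * q + 2\<close> contradicts \<open>n \<ge> 65000\<close>.\<close>
      define P where "P = (h - 24) * (q - 48)"
      have "P < 1154"
        using neg' unfolding P_def by (simp add: algebra_simps)
      have "(h - 24) * 5 \<le> P"
        unfolding P_def using q \<open>h > 25\<close> by (intro mult_left_mono) auto
      moreover have "2 * (q - 48) \<le> P"
        unfolding P_def using q \<open>h > 25\<close> by (intro mult_right_mono) auto
      ultimately have "h \<le> 255 \<and> q \<le> 625"
        using \<open>P < 1154\<close> by simp
      then show False
        using neg' n(2) h by simp
    qed
    have "coprime h q"
      using q(1) \<open>\<not> q dvd h\<close> by (metis coprime_commute prime_imp_coprime)
    have "\<exists>t\<ge>0. t \<le> 1 \<and> coprime (c + 8 * h * t) q" for c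
    proof -
      have "\<not> q dvd 8"
        using q by (auto dest: zdvd_imp_le)
      then have "\<not> (q dvd 8 * h \<and> q dvd c)"
        using \<open>\<not> q dvd h\<close> q(1) prime_dvd_mult_iff by blast
      from progression_avoids_prime[OF this] show ?thesis
        using q(1) by (metis coprime_commute prime_imp_coprime)
    qed
    then show False
      using neg orbit_numerator_coprime_factors[of n h q 1] h \<open>odd h\<close> \<open>h > 0\<close> False \<open>odd q\<close> q
        \<open>coprime h q\<close> bound by auto
  qed
qed

text \<open>A single prime below 48 is too small for \<open>G\<close>, but
  \<open>q * r \<ge> 77\<close> exceeds the 72 required for \<open>T = 2\<close>, the number of
  steps needed to avoid two primes.\<close>

lemma orbit_numerator_two_prime_factors:
  assumes n: "odd n" "n \<ge> 65000" "\<not> is_square n"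
    and q: "prime q" "7 \<le> q" "q \<le> 52" "q dvd n"
    and r: "prime r" "7 \<le> r" "r \<le> 52" "r dvd n" and "q < r"
  shows "orbit_numerator n"
proof (rule ccontr)
  assume neg: "\<not> orbit_numerator n"
  define G where "G = q * r"
  have "coprime q r"
    using q r \<open>q < r\<close> primes_coprime by auto
  then have "G dvd n"
    unfolding G_def using q(4) r(4) divides_mult by blast
  then obtain h where h: "n = h * G"
    by (metis dvdE mult.commute)
  have "odd h" "odd G"
    using n h by auto
  have "r \<ge> 11"
    using prime_ge_7_cases[of r] r q \<open>q < r\<close> by auto
  have "7 * 11 \<le> q * r"
    using q \<open>r \<ge> 11\<close> by (intro mult_mono) auto
  then have G: "G \<ge> 77"
    by (simp add: G_def)
  have "h > 0"
    using n(2) h G zero_less_mult_pos2[of h G] by simp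
  have no_square: "\<not> p\<^sup>2 dvd n" if "prime p" "p \<ge> 7" for p
    using neg orbit_numerator_prime_square_dvd[of n p] n that by auto
  have ndvd: "\<not> q dvd h" "\<not> r dvd h"
  proof -
    show "\<not> q dvd h"
    proof
      assume "q dvd h"
      then have "q * q dvd h * G"
        by (intro mult_dvd_mono) (auto simp: G_def)
      then show False
        using no_square q h by (simp add: power2_eq_square)
    qed
    show "\<not> r dvd h"
    proof
      assume "r dvd h"
      then have "r * r dvd h * G"
        by (intro mult_dvd_mono) (auto simp: G_def)
      then show False
        using no_square r h by (simp add: power2_eq_square)
    qed
  qed
  have "r \<le> 47"
  proof (rule ccontr)
    assume "\<not> r \<le> 47"
    then have "r \<in> {48, 49, 50, 51, 52}"
      using r by auto
    then show False
      using r(1) by auto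
  qed
  then have "q * r \<le> 46 * 47"
    using q r \<open>q < r\<close> by (intro mult_mono) auto
  then have "G \<le> 2162"
    by (simp add: G_def)
  \<comment> \<open>\<open>30 * 2162 < 65000\<close>.\<close>
  have "h > 30"
  proof (rule ccontr)
    assume "\<not> h > 30"
    then have "h * G \<le> 30 * G"
      using G by (intro mult_right_mono) auto
    then show False
      using n h \<open>G \<le> 2162\<close> by simp
  qed
  show False
  proof (cases "is_square h")
    case True
    then obtain m0 where "h = m0\<^sup>2"
      by (elim is_nth_powerE)
    then obtain m where m: "h = m\<^sup>2" "m \<ge> 0"
      using power2_abs[of m0] by (metis abs_ge_zero)
    have "m > 5"
      using \<open>h > 30\<close> m power_less_imp_less_base[of 5 2 m] by simp
    moreover have "odd m"
      using m \<open>odd h\<close> by auto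
    ultimately have "m \<ge> 7"
      by presburger
    then show False
      using neg orbit_numerator_large_square_dvd[of n m] n h m by simp
  next
    case False
    have bound: "24 * h * (2 + 1) + 24 * G + 2 \<le> h * G"
    proof (rule ccontr)
      assume neg': "\<not> ?thesis"
      \<comment> \<open>As for one prime, the required bound is
        \<open>P \<ge> 24 * 72 + 2\<close>.\<close>
      define P where "P = (h - 24) * (G - 72)"
      have "P < 1730"
        using neg' unfolding P_def by (simp add: algebra_simps)
      have "(h - 24) * 5 \<le> P"
        unfolding P_def using G \<open>h > 30\<close> by (intro mult_left_mono) auto
      moreover have "7 * (G - 72) \<le> P"
        unfolding P_def using G \<open>h > 30\<close> by (intro mult_right_mono) auto
      ultimately have "h \<le> 370 \<and> G \<le> 320"
        using \<open>P < 1730\<close> by simp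
      then show False
        using neg' n(2) h by simp
    qed
    have "coprime h q" "coprime h r"
      using q(1) r(1) ndvd by (metis coprime_commute prime_imp_coprime)+
    then have "coprime h G"
      by (simp add: G_def)
    have "\<exists>t\<ge>0. t \<le> 2 \<and> coprime (c + 8 * h * t) G" for c
    proof -
      have "\<not> (p dvd 8 * h \<and> p dvd c)" if "prime p" "p \<ge> 7" "\<not> p dvd h" for p
      proof -
        have "\<not> p dvd 2 ^ 3"
        proof
          assume "p dvd 2 ^ 3"
          then have "p dvd 2"
            using that(1) prime_dvd_power by blast
          then show False
            using that(2) by (auto dest: zdvd_imp_le)
        qed
        then show ?thesis
          using that by (simp add: prime_dvd_mult_iff)
      qed
      then have "\<exists>t. 0 \<le> t \<and> t \<le> 2 \<and> \<not> q dvd c + 8 * h * t \<and> \<not> r dvd c + 8 * h * t"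
        using q r ndvd by (intro progression_avoids_two_primes) auto
      then show ?thesis
        unfolding G_def coprime_mult_right_iff using q(1) r(1)
        by (metis coprime_commute prime_imp_coprime)
    qed
    then show False
      using neg orbit_numerator_coprime_factors[of n h G 2] h \<open>odd h\<close> \<open>h > 0\<close> False \<open>odd G\<close> G
        \<open>coprime h G\<close> bound by auto
  qed
qed

text \<open>After the preceding cases, a counterexample is \<open>3 ^ i * 5 ^ j * w\<close> with
  \<open>w\<close> equal to 1 or a single prime at most 52, and with no factor 81, 225 or 625. Such
  a number is at most \<open>375 * 52\<close>.\<close>

theorem orbit_numerator_odd_ge_65000:
  assumes n: "odd n" "n \<ge> 65000" "\<not> is_square n"
  shows "orbit_numerator n"
proof (rule ccontr)
  assume neg: "\<not> orbit_numerator n"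
  have no_square: "\<not> p\<^sup>2 dvd n" if "p \<ge> 7" for p
    using neg orbit_numerator_large_square_dvd[of n p] n that by auto
  have no_3_5: "\<not> 81 dvd n" "\<not> 225 dvd n" "\<not> 625 dvd n"
    using neg orbit_numerator_3_5_powers n by auto
  have small: "p \<le> 52" if "prime p" "p dvd n" for p
    using neg orbit_numerator_prime_factor_ge_53[of n p] n that by force
  have unique: "p = q" if "prime p" "7 \<le> p" "p dvd n" "prime q" "7 \<le> q" "q dvd n" for p q
    using neg orbit_numerator_two_prime_factors[of n p q] orbit_numerator_two_prime_factors[of n q p]
      n that small by (metis linorder_neqE)
  obtain i m where i: "n = 3 ^ i * m" "\<not> 3 dvd m"
    by (rule multiplicity_decompose'[of n 3]) (use n(2) in auto)
  obtain j w where j: "m = 5 ^ j * w" "\<not> 5 dvd w"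
    by (rule multiplicity_decompose'[of m 5]) (use n(2) i in auto)
  have w3: "\<not> 3 dvd w"
    using i j by auto
  have "i \<le> 3"
    using no_3_5(1) i le_imp_power_dvd[of 4 i "3::int"] by (auto simp: not_le[symmetric] dvd_mult2 intro: leI)
  have "j \<le> 3"
    using no_3_5(3) i j le_imp_power_dvd[of 4 j "5::int"]
    by (auto simp: not_le[symmetric] dvd_mult dvd_mult2 intro: leI)
  have ij: "i \<le> 1 \<or> j \<le> 1"
  proof (rule ccontr)
    assume "\<not> ?thesis"
    then have "3 ^ 2 * 5 ^ 2 dvd (3 ^ i * 5 ^ j :: int)"
      by (intro mult_dvd_mono le_imp_power_dvd) auto
    then show False
      using no_3_5(2) i j by (simp add: dvd_mult2 flip: mult.assoc)
  qed
  have "odd w" "w dvd n"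
    using n(1) i j by auto
  have "0 < 3 ^ i * 5 ^ j * w"
    using n(2) i j by (simp add: mult.assoc)
  then have "w > 0"
    by (rule zero_less_mult_pos) simp
  have "w \<le> 52"
  proof (cases "w = 1")
    case False
    then obtain p where p: "prime p" "p dvd w" "p = 3 \<or> p = 5 \<or> p \<ge> 7"
      using odd_prime_divisor[of w] \<open>odd w\<close> \<open>w > 0\<close> by auto
    have "p \<ge> 7"
      using p w3 j(2) by auto
    have "p dvd n"
      using p(2) \<open>w dvd n\<close> dvd_trans by blast
    obtain v where v: "w = p * v"
      using p(2) by (elim dvdE)
    have "v > 0"
      using \<open>w > 0\<close> v \<open>p \<ge> 7\<close> by (simp add: zero_less_mult_iff)
    have "v = 1"
    proof (rule ccontr)
      assume "v \<noteq> 1"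
      then obtain q where q: "prime q" "q dvd v" "q = 3 \<or> q = 5 \<or> q \<ge> 7"
        using odd_prime_divisor[of v] \<open>odd w\<close> v \<open>v > 0\<close> by auto
      have "q \<ge> 7"
        using q w3 j(2) v by auto
      moreover have "q dvd n"
        using q(2) v \<open>w dvd n\<close> by (meson dvd_trans dvd_triv_right)
      ultimately have "p = q"
        using unique p(1) q(1) \<open>p \<ge> 7\<close> \<open>p dvd n\<close> by blast
      then have "p\<^sup>2 dvd w"
        using q(2) v by (simp add: power2_eq_square)
      then show False
        using no_square[OF \<open>p \<ge> 7\<close>] \<open>w dvd n\<close> dvd_trans by blast
    qed
    then show ?thesis
      using small[OF p(1) \<open>p dvd n\<close>] v by simp
  qed simp
  have "3 ^ i * 5 ^ j \<le> (375 :: int)"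
  proof -
    have "i = 0 \<or> i = 1 \<or> i = 2 \<or> i = 3" "j = 0 \<or> j = 1 \<or> j = 2 \<or> j = 3"
      using \<open>i \<le> 3\<close> \<open>j \<le> 3\<close> by auto
    then show ?thesis
      using ij by auto
  qed
  then have "3 ^ i * 5 ^ j * w \<le> 375 * 52"
    using \<open>w \<le> 52\<close> \<open>w > 0\<close> by (intro mult_mono) auto
  then show False
    using n(2) i j by (simp add: mult.assoc)
qed

subsection \<open>Small numbers\<close>

text \<open>Literal tables for the sieve primes make a test a mere lookup. They include 0, so
  absence certifies the symbol -1; the empty default is reached only at other moduli.\<close>

definition squares_mod :: "int \<Rightarrow> int list" where
  "squares_mod p = (
    if p = 5 then [0, 1, 4]
    else if p = 7 then [0, 1, 2, 4]
    else if p = 11 then [0, 1, 3, 4, 5, 9]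
    else if p = 17 then [0, 1, 2, 4, 8, 9, 13, 15, 16]
    else if p = 19 then [0, 1, 4, 5, 6, 7, 9, 11, 16, 17]
    else if p = 23 then [0, 1, 2, 3, 4, 6, 8, 9, 12, 13, 16, 18]
    else if p = 29 then [0, 1, 4, 5, 6, 7, 9, 13, 16, 20, 22, 23, 24, 25, 28]
    else if p = 31 then [0, 1, 2, 4, 5, 7, 8, 9, 10, 14, 16, 18, 19, 20, 25, 28]
    else if p = 41 then [0, 1, 2, 4, 5, 8, 9, 10, 16, 18, 20, 21, 23, 25, 31, 32, 33, 36, 37,
      39, 40]
    else if p = 43 then [0, 1, 4, 6, 9, 10, 11, 13, 14, 15, 16, 17, 21, 23, 24, 25, 31, 35, 36,
      38, 40, 41]
    else if p = 47 then [0, 1, 2, 3, 4, 6, 7, 8, 9, 12, 14, 16, 17, 18, 21, 24, 25, 27, 28, 32,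
      34, 36, 37, 42]
    else if p = 53 then [0, 1, 4, 6, 7, 9, 10, 11, 13, 15, 16, 17, 24, 25, 28, 29, 36, 37, 38,
      40, 42, 43, 44, 46, 47, 49, 52]
    else if p = 59 then [0, 1, 3, 4, 5, 7, 9, 12, 15, 16, 17, 19, 20, 21, 22, 25, 26, 27, 28,
      29, 35, 36, 41, 45, 46, 48, 49, 51, 53, 57]
    else if p = 67 then [0, 1, 4, 6, 9, 10, 14, 15, 16, 17, 19, 21, 22, 23, 24, 25, 26, 29, 33,
      35, 36, 37, 39, 40, 47, 49, 54, 55, 56, 59, 60, 62, 64, 65]
    else if p = 71 then [0, 1, 2, 3, 4, 5, 6, 8, 9, 10, 12, 15, 16, 18, 19, 20, 24, 25, 27, 29,
      30, 32, 36, 37, 38, 40, 43, 45, 48, 49, 50, 54, 57, 58, 60, 64]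
    else if p = 79 then [0, 1, 2, 4, 5, 8, 9, 10, 11, 13, 16, 18, 19, 20, 21, 22, 23, 25, 26,
      31, 32, 36, 38, 40, 42, 44, 45, 46, 49, 50, 51, 52, 55, 62, 64, 65, 67, 72, 73, 76]
    else if p = 83 then [0, 1, 3, 4, 7, 9, 10, 11, 12, 16, 17, 21, 23, 25, 26, 27, 28, 29, 30,
      31, 33, 36, 37, 38, 40, 41, 44, 48, 49, 51, 59, 61, 63, 64, 65, 68, 69, 70, 75, 77, 78,
      81]
    else if p = 89 then [0, 1, 2, 4, 5, 8, 9, 10, 11, 16, 17, 18, 20, 21, 22, 25, 32, 34, 36,
      39, 40, 42, 44, 45, 47, 49, 50, 53, 55, 57, 64, 67, 68, 69, 71, 72, 73, 78, 79, 80, 81,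
      84, 85, 87, 88]
    else if p = 101 then [0, 1, 4, 5, 6, 9, 13, 14, 16, 17, 19, 20, 21, 22, 23, 24, 25, 30, 31,
      33, 36, 37, 43, 45, 47, 49, 52, 54, 56, 58, 64, 65, 68, 70, 71, 76, 77, 78, 79, 80, 81,
      82, 84, 85, 87, 88, 92, 95, 96, 97, 100]
    else if p = 113 then [0, 1, 2, 4, 7, 8, 9, 11, 13, 14, 15, 16, 18, 22, 25, 26, 28, 30, 31,
      32, 36, 41, 44, 49, 50, 51, 52, 53, 56, 57, 60, 61, 62, 63, 64, 69, 72, 77, 81, 82, 83,
      85, 87, 88, 91, 95, 97, 98, 99, 100, 102, 104, 105, 106, 109, 111, 112]
    else if p = 137 then [0, 1, 2, 4, 7, 8, 9, 11, 14, 15, 16, 17, 18, 19, 22, 25, 28, 30, 32,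
      34, 36, 37, 38, 39, 44, 49, 50, 56, 59, 60, 61, 63, 64, 65, 68, 69, 72, 73, 74, 76, 77,
      78, 81, 87, 88, 93, 98, 99, 100, 101, 103, 105, 107, 109, 112, 115, 118, 119, 120, 121,
      122, 123, 126, 128, 129, 130, 133, 135, 136]
    else if p = 149 then [0, 1, 4, 5, 6, 7, 9, 16, 17, 19, 20, 22, 24, 25, 26, 28, 29, 30, 31,
      33, 35, 36, 37, 39, 42, 45, 46, 47, 49, 53, 54, 61, 63, 64, 67, 68, 69, 73, 76, 80, 81,
      82, 85, 86, 88, 95, 96, 100, 102, 103, 104, 107, 110, 112, 113, 114, 116, 118, 119, 120,
      121, 123, 124, 125, 127, 129, 130, 132, 133, 140, 142, 143, 144, 145, 148]
    else if p = 173 then [0, 1, 4, 6, 9, 10, 13, 14, 15, 16, 21, 22, 23, 24, 25, 29, 31, 33, 34,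
      35, 36, 37, 38, 40, 41, 43, 47, 49, 51, 52, 54, 55, 56, 57, 60, 64, 67, 73, 77, 78, 81,
      83, 84, 85, 88, 89, 90, 92, 95, 96, 100, 106, 109, 113, 116, 117, 118, 119, 121, 122, 124,
      126, 130, 132, 133, 135, 136, 137, 138, 139, 140, 142, 144, 148, 149, 150, 151, 152, 157,
      158, 159, 160, 163, 164, 167, 169, 172]
    else if p = 197 then [0, 1, 4, 6, 7, 9, 10, 15, 16, 19, 22, 23, 24, 25, 26, 28, 29, 33, 34,
      36, 37, 39, 40, 41, 42, 43, 47, 49, 51, 53, 54, 55, 59, 60, 61, 62, 63, 64, 65, 70, 76,
      81, 83, 85, 88, 90, 92, 93, 96, 97, 100, 101, 104, 105, 107, 109, 112, 114, 116, 121, 127,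
      132, 133, 134, 135, 136, 137, 138, 142, 143, 144, 146, 148, 150, 154, 155, 156, 157, 158,
      160, 161, 163, 164, 168, 169, 171, 172, 173, 174, 175, 178, 181, 182, 187, 188, 190, 191,
      193, 196]
    else [])"

definition sieve_primes_5_mod_12 :: "int list" where
  "sieve_primes_5_mod_12 = [5, 17, 29, 41, 53, 89, 101, 113, 137, 149, 173, 197]"

definition sieve_primes_3_mod_4 :: "int list" where
  "sieve_primes_3_mod_4 = [7, 11, 19, 23, 31, 43, 47, 59, 67, 71, 79, 83]"

lemma squares_mod_complete:
  assumes "p \<in> set (sieve_primes_5_mod_12 @ sieve_primes_3_mod_4)"
  shows "x * x mod p \<in> set (squares_mod p)"
proof -
  have "list_all (\<lambda>p. list_all (\<lambda>x. List.member (squares_mod p) (x * x mod p)) [0..p div 2])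
          (sieve_primes_5_mod_12 @ sieve_primes_3_mod_4)"
    by code_simp
  then have half: "y * y mod p \<in> set (squares_mod p)" if "0 \<le> y" "y \<le> p div 2" for y
    using assms that by (auto simp: list_all_iff)
  have p: "p > 0"
    using assms by (auto simp: sieve_primes_5_mod_12_def sieve_primes_3_mod_4_def)
  define z where "z = x mod p"
  have z: "0 \<le> z" "z < p" "x * x mod p = z * z mod p"
    using p by (auto simp: z_def mod_mult_eq)
  show ?thesis
  proof (cases "z \<le> p div 2")
    case True
    then show ?thesis using half[of z] z by simp
  next
    case False
    have "(p - z) * (p - z) - z * z = p * (p - 2 * z)"
      by (simp add: algebra_simps)
    then have "(p - z) * (p - z) mod p = z * z mod p"
      by (simp only: mod_eq_dvd_iff dvd_triv_left)
    moreover have "p - z \<le> p div 2"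
      using False by linarith
    ultimately show ?thesis
      using half[of "p - z"] z by simp
  qed
qed

lemma sieve_primes:
  "\<forall>p\<in>set sieve_primes_5_mod_12. prime p \<and> p mod 12 = 5"
  "\<forall>p\<in>set sieve_primes_3_mod_4. prime p \<and> p mod 4 = 3 \<and> \<not> 3 dvd p"
  by (simp_all add: sieve_primes_5_mod_12_def sieve_primes_3_mod_4_def)

text \<open>The factor \<open>m\<close> is 2 or 6, according to the size condition of the criterion
  for \<open>n mod 3 = 1\<close> or for \<open>9 dvd n\<close>. The primes are listed in increasing
  order, so the search may stop at the first one too large.\<close>

primrec sieve :: "int list \<Rightarrow> int \<Rightarrow> int \<Rightarrow> bool" where
  "sieve [] m n = False"
| "sieve (p # ps) m n =
     (if m * p \<le> n then if List.member (squares_mod p) (n mod p) then sieve ps m n else True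
      else False)"

lemma sieveD:
  assumes "sieve ps m n"
  shows "\<exists>p\<in>set ps. m * p \<le> n \<and> n mod p \<notin> set (squares_mod p)"
  using assms by (induction ps) (auto split: if_splits)

lemma kronecker_eq_minus_one:
  assumes "p \<in> set (sieve_primes_5_mod_12 @ sieve_primes_3_mod_4)"
    and "n mod p \<notin> set (squares_mod p)"
  shows "kronecker n p = -1"
proof -
  have p: "prime p" "p \<noteq> 2"
    using assms(1) sieve_primes by auto
  have "\<not> [n = 0] (mod p)"
    using squares_mod_complete[OF assms(1), of 0] assms(2) by (auto simp: cong_def)
  moreover have "\<not> QuadRes p n"
    using squares_mod_complete[OF assms(1)] assms(2)
    by (auto simp: QuadRes_def cong_def power2_eq_square) (metis)
  ultimately show ?thesis
    using p by (simp add: kronecker_prime_right Legendre_def)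
qed

lemma orbit_numerator_sieve_5_mod_12:
  assumes "n mod 3 = 1" "sieve ps 2 n" "set ps \<subseteq> set sieve_primes_5_mod_12"
  shows "orbit_numerator n"
proof -
  obtain p where "p \<in> set ps" "2 * p \<le> n" "n mod p \<notin> set (squares_mod p)"
    using sieveD[OF assms(2)] by blast
  then show ?thesis
    using assms sieve_primes(1) kronecker_eq_minus_one[of p n]
    by (intro orbit_numerator_mod_3_eq_1[of n p]) (auto simp: prime_gt_0_int)
qed

lemma orbit_numerator_sieve_3_mod_4:
  assumes "9 dvd n" "sieve ps 6 n" "set ps \<subseteq> set sieve_primes_3_mod_4"
  shows "orbit_numerator n"
proof -
  obtain p where "p \<in> set ps" "6 * p \<le> n" "n mod p \<notin> set (squares_mod p)"
    using sieveD[OF assms(2)] by blast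
  then show ?thesis
    using assms sieve_primes(2) kronecker_eq_minus_one[of p n]
    by (intro orbit_numerator_9_dvd[of n p]) (auto simp: prime_gt_0_int)
qed

text \<open>Integer square root by binary digits: the weights 128 down to 1 reach all numbers below
  \<open>256 * 256\<close>, hence all below 65000.\<close>

primrec square_test :: "int list \<Rightarrow> int \<Rightarrow> int \<Rightarrow> bool" where
  "square_test [] a n = (a * a = n)"
| "square_test (d # ds) a n =
     (if (a + d) * (a + d) \<le> n then square_test ds (a + d) n else square_test ds a n)"

lemma square_testD: "square_test ds a n \<Longrightarrow> is_square n"
proof (induction ds arbitrary: a)
  case Nil
  then show ?case
    by (intro is_nth_powerI[of _ a]) (simp add: power2_eq_square)
qed (auto split: if_splits)

definition exceptions :: "int list" where
  "exceptions = [3, 6, 7, 10, 12, 15, 18, 19, 27, 31, 34, 55, 63, 99, 115]"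

definition sieved :: "int list \<Rightarrow> int \<Rightarrow> int \<Rightarrow> bool" where
  "sieved ps m n =
     (if sieve ps m n then True
      else if square_test [128, 64, 32, 16, 8, 4, 2, 1] 0 n then True
      else List.member exceptions n)"

lemma sievedD: "sieved ps m n \<Longrightarrow> sieve ps m n \<or> is_square n \<or> n \<in> set exceptions"
  using square_testD by (auto simp: sieved_def simp del: square_test.simps split: if_splits)

lemma sieved_1_mod_3_lt_500:
  "list_all (\<lambda>k. sieved sieve_primes_5_mod_12 2 (3 * k + 1)) [0..166]"
  by code_simp

lemma sieved_9_dvd_lt_500:
  "list_all (\<lambda>k. sieved sieve_primes_3_mod_4 6 (9 * k)) [1..55]"
  by code_simp

text \<open>
  The progressions modulo \<open>24 \<cdot> 5 \<cdot> 17\<close> or \<open>72 \<cdot> 7 \<cdot> 11\<close> that consist of nonresidues modulo one of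
  the two primes are discarded as a whole.
\<close>

definition sieved_progression :: "int list \<Rightarrow> int \<Rightarrow> int \<Rightarrow> int \<Rightarrow> int \<Rightarrow> int \<Rightarrow> bool" where
  "sieved_progression ps m p q M r =
     (if List.member (squares_mod p) (r mod p)
      then if List.member (squares_mod q) (r mod q)
        then list_all (\<lambda>k. let n = M * k + r in if n < 500 then True else sieved ps m n) [0..65000 div M]
        else True
      else True)"

text \<open>From 500 on the size conditions for \<open>p\<close> and \<open>q\<close> hold, so a
  progression discarded modulo one of them passes the sieve at that prime.\<close>

lemma sieved_progressionD:
  assumes "sieved_progression ps m p q M (n mod M)" "M > 0" "p dvd M" "q dvd M"
    and "m * p \<le> 500" "m * q \<le> 500" "500 \<le> n" "n < 65000"
  shows "sieve (p # q # ps) m n \<or> is_square n \<or> n \<in> set exceptions"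
proof -
  have "n div M \<le> 65000 div M"
    using assms by (intro zdiv_mono1) auto
  moreover have "0 \<le> n div M"
    using assms by (simp add: pos_imp_zdiv_nonneg_iff)
  ultimately have "n div M \<in> set [0..65000 div M]"
    by simp
  moreover have "M * (n div M) + n mod M = n"
    by simp
  moreover have "n mod M mod p = n mod p" "n mod M mod q = n mod q"
    using assms by (simp_all add: mod_mod_cancel)
  ultimately show ?thesis
    using assms sievedD[of ps m n]
    by (auto simp: sieved_progression_def list_all_iff Let_def simp del: set_upto split: if_splits)
qed

text \<open>Odd numbers that are 1 modulo 3 are 1, 7, 13 or 19 modulo 24. The class 13 is 5 modulo 8
  and has an explicit witness.\<close>

lemma sieved_1_mod_24:
  "list_all (\<lambda>j. sieved_progression (drop 2 sieve_primes_5_mod_12) 2 5 17 2040 (24 * j + 1)) [0..84]"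
  by code_simp

lemma sieved_7_mod_24:
  "list_all (\<lambda>j. sieved_progression (drop 2 sieve_primes_5_mod_12) 2 5 17 2040 (24 * j + 7)) [0..84]"
  by code_simp

lemma sieved_19_mod_24:
  "list_all (\<lambda>j. sieved_progression (drop 2 sieve_primes_5_mod_12) 2 5 17 2040 (24 * j + 19)) [0..84]"
  by code_simp

text \<open>Odd multiples of 9 are 9, 27, 45 or 63 modulo 72, and 45 is 5 modulo 8.\<close>

lemma sieved_9_mod_72:
  "list_all (\<lambda>j. sieved_progression (drop 2 sieve_primes_3_mod_4) 6 7 11 5544 (72 * j + 9)) [0..76]"
  by code_simp

lemma sieved_27_mod_72:
  "list_all (\<lambda>j. sieved_progression (drop 2 sieve_primes_3_mod_4) 6 7 11 5544 (72 * j + 27)) [0..76]"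
  by code_simp

lemma sieved_63_mod_72:
  "list_all (\<lambda>j. sieved_progression (drop 2 sieve_primes_3_mod_4) 6 7 11 5544 (72 * j + 63)) [0..76]"
  by code_simp

subsection \<open>The exceptional set\<close>

lemma list_all_progression:
  fixes n d M c :: int
  assumes "list_all (\<lambda>j. P (d * j + c)) [0..M div d - 1]" "d > 0" "d dvd M" "M > 0" "n mod d = c"
  shows "P (n mod M)"
proof -
  obtain e where e: "M = d * e"
    using assms(3) by (elim dvdE)
  have c: "n mod M mod d = c"
    using assms by (simp add: mod_mod_cancel)
  define j where "j = n mod M div d"
  have "n mod M = d * j + c"
    unfolding j_def c[symmetric] by simp
  moreover have "0 \<le> j"
    using assms by (simp add: j_def pos_imp_zdiv_nonneg_iff)
  moreover have "j < e"
  proof -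
    have "d * j + c < d * e"
      using calculation(1) assms(4) pos_mod_bound[of M n] e by simp
    moreover have "0 \<le> c"
      using assms by (metis pos_mod_sign)
    ultimately have "d * j < d * e"
      by linarith
    then show ?thesis
      using assms(2) by simp
  qed
  ultimately show ?thesis
    using assms(1,2) e by (auto simp: list_all_iff)
qed

lemma orbit_numerator_sieve_1_mod_3:
  assumes "n mod 3 = 1" "0 < n" "n < 65000" "n < 500 \<or> odd n" "\<not> is_square n" "n \<notin> set exceptions"
  shows "orbit_numerator n"
proof (cases "n < 500")
  case True
  have "3 * (n div 3) + 1 = n"
    using assms(1) by presburger
  moreover from this have "n div 3 \<in> set [0..166]"
    using True assms(2) by simp
  ultimately have "sieved sieve_primes_5_mod_12 2 n"
    using sieved_1_mod_3_lt_500 by (metis list_all_iff)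
  then show ?thesis
    using sievedD assms orbit_numerator_sieve_5_mod_12[of n sieve_primes_5_mod_12] by auto
next
  case False
  then have "odd n"
    using assms by simp
  show ?thesis
  proof (cases "n mod 8 = 5")
    case True
    then show ?thesis
      using orbit_numerator_mod_8_eq_5 assms by blast
  next
    case neq: False
    define q where "q = n div 24"
    have "n = 6 * (n div 6) + 1"
      using \<open>odd n\<close> assms(1) by presburger
    moreover have "n div 6 = 4 * q + n div 6 mod 4"
      unfolding q_def using div_mult_mod_eq[of "n div 6" 4] by (simp add: zdiv_zmult2_eq[of 4 n 6, symmetric])
    moreover have "n div 6 mod 4 = 0 \<or> n div 6 mod 4 = 1 \<or> n div 6 mod 4 = 2 \<or> n div 6 mod 4 = 3"
      by presburger
    \<comment> \<open>The third case is the class 13 modulo 24, written so that its residue 5 modulo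
      8 is visible.\<close>
    ultimately have "n = 1 + 24 * q \<or> n = 7 + 24 * q \<or> n = 5 + 8 * (1 + 3 * q) \<or> n = 19 + 24 * q"
      by auto
    moreover have "n \<noteq> 5 + 8 * (1 + 3 * q)"
      using neq mod_mult_self2[of 5 8 "1 + 3 * q"] by auto
    ultimately have "n mod 24 = 1 \<or> n mod 24 = 7 \<or> n mod 24 = 19"
      by auto
    then have "sieved_progression (drop 2 sieve_primes_5_mod_12) 2 5 17 2040 (n mod 2040)"
      using list_all_progression[of "sieved_progression (drop 2 sieve_primes_5_mod_12) 2 5 17 2040" 24 _ 2040 n]
        sieved_1_mod_24 sieved_7_mod_24 sieved_19_mod_24
      by (elim disjE) simp_all
    then have "sieve (5 # 17 # drop 2 sieve_primes_5_mod_12) 2 n"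
      using sieved_progressionD[of _ 2 5 17 2040 n] False assms by auto
    then show ?thesis
      by (rule orbit_numerator_sieve_5_mod_12[OF assms(1)]) (auto simp: sieve_primes_5_mod_12_def)
  qed
qed

lemma orbit_numerator_sieve_9_dvd:
  assumes "9 dvd n" "0 < n" "n < 65000" "n < 500 \<or> odd n" "\<not> is_square n" "n \<notin> set exceptions"
  shows "orbit_numerator n"
proof (cases "n < 500")
  case True
  obtain k where k: "n = 9 * k"
    using assms(1) by (elim dvdE)
  then have "k \<in> set [1..55]"
    using True assms(2) by simp
  then have "sieved sieve_primes_3_mod_4 6 n"
    using sieved_9_dvd_lt_500 k by (metis list_all_iff)
  then show ?thesis
    using sievedD assms orbit_numerator_sieve_3_mod_4[of n sieve_primes_3_mod_4] by auto
next
  case False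
  then have "odd n"
    using assms by simp
  show ?thesis
  proof (cases "n mod 8 = 5")
    case True
    then show ?thesis
      using orbit_numerator_mod_8_eq_5 assms by blast
  next
    case neq: False
    obtain k where k: "n = 9 * k"
      using assms(1) by (elim dvdE)
    have "odd k" "k mod 8 = n mod 8"
      using \<open>odd n\<close> by (simp_all add: k mod_eq_dvd_iff)
    then have "k mod 8 = 1 \<or> k mod 8 = 3 \<or> k mod 8 = 7"
      using neq by presburger
    then have "n mod 72 = 9 \<or> n mod 72 = 27 \<or> n mod 72 = 63"
      using mult_mod_right[of 9 k 8] k by auto
    then have "sieved_progression (drop 2 sieve_primes_3_mod_4) 6 7 11 5544 (n mod 5544)"
      using list_all_progression[of "sieved_progression (drop 2 sieve_primes_3_mod_4) 6 7 11 5544" 72 _ 5544 n]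
        sieved_9_mod_72 sieved_27_mod_72 sieved_63_mod_72
      by (elim disjE) simp_all
    then have "sieve (7 # 11 # drop 2 sieve_primes_3_mod_4) 6 n"
      using sieved_progressionD[of _ 6 7 11 5544 n] False assms by auto
    then show ?thesis
      by (rule orbit_numerator_sieve_3_mod_4[OF assms(1)]) (auto simp: sieve_primes_3_mod_4_def)
  qed
qed

lemma orbit_numerator_lt_65000:
  assumes "0 < n" "n < 65000" "n < 500 \<or> odd n" "\<not> is_square n" "n \<notin> set exceptions"
  shows "orbit_numerator n"
proof -
  have "n mod 3 = 1 \<or> n mod 3 = 2 \<or> 3 dvd n"
    by presburger
  then consider "n mod 3 = 1" | "n mod 3 = 2" | "9 dvd n" | "3 dvd n" "\<not> 9 dvd n"
    by blast
  then show ?thesis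
  proof cases
    case 4
    then obtain m where m: "n = 3 * m"
      by (elim dvdE)
    then have "\<not> 3 dvd m"
      using 4(2) by auto
    have "m \<ge> 6"
    proof (rule ccontr)
      assume "\<not> m \<ge> 6"
      then have "m \<in> {1, 2, 3, 4, 5}"
        using assms(1) m by auto
      then show False
        using assms(5) m \<open>\<not> 3 dvd m\<close> by (auto simp: exceptions_def)
    qed
    then show ?thesis
      using orbit_numerator_3_mult \<open>\<not> 3 dvd m\<close> m by blast
  qed (use assms orbit_numerator_sieve_1_mod_3 orbit_numerator_sieve_9_dvd
        orbit_numerator_mod_3_eq_2 in blast)+
qed

text \<open>Even numbers from 500 on are 2 or 6 modulo 8, with explicit witnesses, or are reduced by
  a factor 4. The quotient is at least 125, beyond the largest exception 115.\<close>

theorem orbit_numerator_if_not_square: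
  assumes "n > 0" "\<not> is_square n" "n \<notin> set exceptions"
  shows "orbit_numerator n"
  using assms
proof (induction "nat n" arbitrary: n rule: less_induct)
  case less
  consider "n < 500 \<or> odd n" | "n \<ge> 500" "even n"
    by linarith
  then show ?case
  proof cases
    case 1
    then show ?thesis
      using less.prems orbit_numerator_lt_65000[of n] orbit_numerator_odd_ge_65000[of n] by linarith
  next
    case 2
    show ?thesis
    proof (cases "4 dvd n")
      case True
      then obtain m where m: "n = 4 * m"
        by (elim dvdE)
      have "\<not> is_square m"
        using less.prems(2) is_square_times_square[of m 2] m by (auto simp: mult.commute)
      moreover have "m \<notin> set exceptions"
        using 2 m by (auto simp: exceptions_def)
      ultimately have "orbit_numerator m"
        using less.hyps[of m] less.prems m by simp
      then show ?thesis
        using orbit_numerator_4_mult m by blast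
    next
      case False
      then have "n mod 8 = 2 \<or> n mod 8 = 6"
        using 2(2) by presburger
      then show ?thesis
        using orbit_numerator_mod_8_eq_2[of n] orbit_numerator_mod_8_eq_6[of n] 2(1) by auto
    qed
  qed
qed

text \<open>A checkable reason for \<open>(b/a)\<close> not to be 1: a common factor, a nonresidue
  modulo a sieve prime, or the single remaining pair with
  \<open>(19/21) = (19/3) (19/7) = -1\<close>.\<close>

definition excluded_pair :: "int \<Rightarrow> int \<Rightarrow> bool" where
  "excluded_pair a b =
     (if gcd b a = 1
      then if List.member sieve_primes_5_mod_12 a then \<not> List.member (squares_mod a) (b mod a)
        else a = 21 \<and> b = 19
      else True)"

lemma exceptions_excluded:
  "list_all (\<lambda>n. list_all (\<lambda>c. let b = (n - 2 * (4 * c + 1)) div 3 in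
     if 0 \<le> b \<and> 2 * (4 * c + 1) + 3 * b = n then excluded_pair (4 * c + 1) b else True) [0..14]) exceptions"
  by code_simp

lemma exceptions_not_orbit_numerator:
  assumes "n \<in> set exceptions"
  shows "\<not> orbit_numerator n"
proof
  assume "orbit_numerator n"
  then obtain a b where ab: "a > 0" "a mod 4 = 1" "b \<ge> 0" "kronecker b a = 1" "n = 2 * a + 3 * b"
    unfolding orbit_numerator_def by blast
  define c where "c = a div 4"
  have a: "a = 4 * c + 1"
    using ab(2) unfolding c_def by presburger
  have "n \<le> 115"
    using assms by (auto simp: exceptions_def)
  \<comment> \<open>From \<open>2 * a \<le> 115\<close> follows
    \<open>a \<le> 57 = 4 * 14 + 1\<close>.\<close>
  then have "c \<in> set [0..14]"
    using ab a by auto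
  moreover have "(n - 2 * (4 * c + 1)) div 3 = b"
    using ab(5) a by simp
  ultimately have "excluded_pair (4 * c + 1) b"
    using exceptions_excluded assms ab(3,5) a by (fastforce simp: list_all_iff Let_def simp del: set_upto)
  moreover have "odd a"
    using ab odd_if_mod_4_eq_1 by blast
  then have "gcd b a = 1"
    using kronecker_eq_0_iff[of a b] ab by (auto simp: coprime_iff_gcd_eq_1)
  ultimately have "a \<in> set sieve_primes_5_mod_12 \<and> b mod a \<notin> set (squares_mod a) \<or> a = 21 \<and> b = 19"
    unfolding a[symmetric] by (auto simp: excluded_pair_def split: if_splits)
  then show False
  proof
    assume "a \<in> set sieve_primes_5_mod_12 \<and> b mod a \<notin> set (squares_mod a)"
    then show False
      using kronecker_eq_minus_one[of a b] ab(4) by simp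
  next
    assume *: "a = 21 \<and> b = 19"
    have "kronecker 19 3 = kronecker 1 3"
      by (rule kronecker_cong) (auto simp: cong_def)
    moreover have "kronecker 19 7 = -1"
      by (rule kronecker_eq_minus_one) (simp_all add: sieve_primes_3_mod_4_def squares_mod_def)
    ultimately have "kronecker 19 (3 * 7) = -1"
      by (subst kronecker_mult_right) simp_all
    then show False
      using * ab(4) by simp
  qed
qed

theorem theorem2p7:
  shows "{n :: int. 0 < n \<and> n \<notin> numerators (Psi_orbit (vector [2, 3]))} =
         {n ^ 2 | n :: int. 0 < n} \<union>
         {3, 6, 7, 10, 12, 15, 18, 19, 27, 31, 34, 55, 63, 99, 115}"
proof -
  have "0 < n \<and> \<not> orbit_numerator n \<longleftrightarrow> (\<exists>m>0. n = m\<^sup>2) \<or> n \<in> set exceptions" for n :: int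
  proof
    assume "0 < n \<and> \<not> orbit_numerator n"
    then have "n > 0" "is_square n \<or> n \<in> set exceptions"
      using orbit_numerator_if_not_square by blast+
    then show "(\<exists>m>0. n = m\<^sup>2) \<or> n \<in> set exceptions"
    proof (elim disjE)
      assume "is_square n"
      then obtain m where "n = m\<^sup>2"
        by (elim is_nth_powerE)
      then have "n = \<bar>m\<bar>\<^sup>2" "\<bar>m\<bar> > 0"
        using \<open>n > 0\<close> by auto
      then show ?thesis
        by blast
    qed simp
  next
    assume "(\<exists>m>0. n = m\<^sup>2) \<or> n \<in> set exceptions"
    then show "0 < n \<and> \<not> orbit_numerator n"
      using square_not_orbit_numerator exceptions_not_orbit_numerator
      by (auto simp: exceptions_def)
  qed
  then show ?thesis
    unfolding numerators_Psi_orbit_iff by (auto simp: exceptions_def)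
qed

end
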